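(* Let $\omega$ be a positive superharmonic function on the open unit disk $\mathbb{D}$, let $f\in\mathcal{D}_\omega$, and let $\alpha>1/2$. Then $\sigma_n^\alpha[f]\to f$ in the norm of $\mathcal{D}_\omega$ as $n\to\infty$, that is, $\|\sigma_n^\alpha[f]-f\|_{\mathcal{D}_\omega}\to0$.
   Context: $\mathbb{D}$ is the open unit disk in $\mathbb{C}$ and $dA$ is normalized area measure on $\mathbb{D}$. For a positive superharmonic function $\omega$ on $\mathbb{D}$ (a "superharmonic weight") and a holomorphic function $f$ on $\mathbb{D}$, set $\mathcal{D}_\omega(f):=\int_{\mathbb{D}}|f'(z)|^2\,\omega(z)\,dA(z)$. The weighted Dirichlet space $\mathcal{D}_\omega$ is the set of holomorphic $f$ on $\mathbb{D}$ with $\mathcal{D}_\omega(f)<\infty$; with the norm $\|f\|_{\mathcal{D}_\omega}^2:=|f(0)|^2+\mathcal{D}_\omega(f)$ it is a Hilbert space containing the polynomials. For $f(z)=\sum_{k=0}^\infty a_kz^k$ and $\alpha>0$, the generalized Cesàro means are $$\sigma_n^\alpha[f](z):=\binom{n+\alpha}{\alpha}^{-1}\sum_{k=0}^n\binom{n-k+\alpha}{\alpha}a_kz^k,\qquad \binom{n+\alpha}{\alpha}:=\frac{\Gamma(n+\alpha+1)}{\Gamma(\alpha+1)\Gamma(n+1)},$$ where $\Gamma$ is the gamma function. *)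

theory Defs
  imports "HOL-Complex_Analysis.Complex_Analysis"
begin

text \<open>
  The mean of an extended-real function over the circle of centre w and radius r, as the
  difference of the integrals of its positive and negative parts. A lower semicontinuous function
  that never takes the value \<open>-\<infinity>\<close> is bounded below on the circle, so for such a function the
  subtracted term is finite.
\<close>

definition circle_mean :: "(complex \<Rightarrow> ereal) \<Rightarrow> complex \<Rightarrow> real \<Rightarrow> ereal" where
  "circle_mean u w r =
     (enn2ereal (\<integral>\<^sup>+ t \<in> {0..2 * pi}. e2ennreal (u (w + of_real r * cis t)) \<partial>lborel)
      - enn2ereal (\<integral>\<^sup>+ t \<in> {0..2 * pi}. e2ennreal (- u (w + of_real r * cis t)) \<partial>lborel))
     / ereal (2 * pi)"

text \<open>
  Superharmonic functions on a domain: values in \<open>(-\<infinity>, \<infinity>]\<close>, not identically \<open>\<infinity>\<close>, lower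
  semicontinuous, and satisfying the super-mean-value inequality on every closed disk in the domain.
\<close>

definition superharmonic_on :: "complex set \<Rightarrow> (complex \<Rightarrow> ereal) \<Rightarrow> bool" where
  "superharmonic_on U u \<longleftrightarrow>
     open U \<and> connected U \<and>
     (\<forall>z\<in>U. u z \<noteq> -\<infinity>) \<and> (\<exists>z\<in>U. u z \<noteq> \<infinity>) \<and>
     (\<forall>a. open {z \<in> U. a < u z}) \<and>
     (\<forall>w r. 0 < r \<longrightarrow> cball w r \<subseteq> U \<longrightarrow> circle_mean u w r \<le> u w)"

definition superharmonic_weight :: "(complex \<Rightarrow> ereal) \<Rightarrow> bool" where
  "superharmonic_weight \<omega> \<longleftrightarrow> superharmonic_on (ball 0 1) \<omega> \<and> (\<forall>z\<in>ball 0 1. 0 < \<omega> z)"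

text \<open>The factor \<open>1 / pi\<close> normalizes area measure so that the unit disk has measure 1.\<close>

definition dirichlet_integral :: "(complex \<Rightarrow> ereal) \<Rightarrow> (complex \<Rightarrow> complex) \<Rightarrow> ennreal" where
  "dirichlet_integral \<omega> f =
     ennreal (1 / pi) *
     (\<integral>\<^sup>+ z \<in> ball 0 1. ennreal ((cmod (deriv f z))\<^sup>2) * e2ennreal (\<omega> z) \<partial>lborel)"

definition dirichlet_space :: "(complex \<Rightarrow> ereal) \<Rightarrow> (complex \<Rightarrow> complex) set" where
  "dirichlet_space \<omega> = {f. f holomorphic_on ball 0 1 \<and> dirichlet_integral \<omega> f < \<infinity>}"

text \<open>
  The norm is extended by the value \<open>\<infinity>\<close> when the Dirichlet integral diverges, so that
  convergence to 0 of norms cannot hold because of a junk value.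
\<close>

definition dirichlet_norm :: "(complex \<Rightarrow> ereal) \<Rightarrow> (complex \<Rightarrow> complex) \<Rightarrow> ennreal" where
  "dirichlet_norm \<omega> f =
     (if dirichlet_integral \<omega> f < \<infinity>
      then ennreal (sqrt ((cmod (f 0))\<^sup>2 + enn2real (dirichlet_integral \<omega> f)))
      else \<infinity>)"

text \<open>The generalized binomial coefficient \<open>binom (n + \<alpha>) \<alpha>\<close>.\<close>

definition cesaro_binomial :: "real \<Rightarrow> nat \<Rightarrow> real" where
  "cesaro_binomial \<alpha> n = Gamma (real n + \<alpha> + 1) / (Gamma (\<alpha> + 1) * Gamma (real n + 1))"

definition cesaro_mean :: "real \<Rightarrow> nat \<Rightarrow> (complex \<Rightarrow> complex) \<Rightarrow> complex \<Rightarrow> complex" where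
  "cesaro_mean \<alpha> n f z =
     of_real (inverse (cesaro_binomial \<alpha> n)) *
     (\<Sum>k\<le>n. of_real (cesaro_binomial \<alpha> (n - k)) * fps_nth (fps_expansion f 0) k * z ^ k)"

end

theory Submission
  imports Defs
begin

text \<open>
  Write \<open>D(f)\<close> for the Dirichlet integral with weight \<open>\<omega>\<close>. Since \<open>|f'|\<^sup>2\<close> is a quarter of the Laplacian
  of \<open>|f|\<^sup>2\<close>, the combinations \<open>D(g) - D(z g)\<close> and \<open>D(g) - 2 D(z g) + D(z\<^sup>2 g)\<close> are integrals of
  \<open>\<omega>\<close> against Laplacians of \<open>(1 - |z|\<^sup>2) |g|\<^sup>2\<close> and \<open>(1 - |z|\<^sup>2)\<^sup>2 |g|\<^sup>2\<close>. Both functions are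
  nonnegative on the disc and vanish on the circle, so positivity and superharmonicity of \<open>\<omega>\<close> make
  both combinations nonpositive: multiplication by \<open>z\<close> is expansive and concave for \<open>D\<close>
  (\<open>superharmonic_test_inequality\<close>, \<open>energy_form_concave_shift_form\<close>).
  
  The rest of the estimate is algebra. By the two inequalities, \<open>B(g) = D(z g) - D(g)\<close> is the square
  of a seminorm for which multiplication by \<open>z\<close> is a contraction. Because \<open>D\<close> ignores constants,
  telescoping gives \<open>D(f) = B(v\<^sub>1) + B(v\<^sub>2) + ...\<close>, where \<open>v\<^sub>i\<close> is the \<open>i\<close>-fold backward shift of \<open>f\<close>.
  If \<open>w\<^sub>i\<close> are the backward shifts of the series with coefficients \<open>c\<^sub>k a\<^sub>k\<close>, then
  \<open>w\<^sub>i - c\<^sub>i v\<^sub>i = z (w\<^sub>i\<^sub>+\<^sub>1 - c\<^sub>i v\<^sub>i\<^sub>+\<^sub>1)\<close>. Iterating this with the triangle inequality bounds \<open>w\<^sub>i - c\<^sub>i v\<^sub>i\<close>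
  by the sum over \<open>j > i\<close> of \<open>|c\<^sub>j - c\<^sub>j\<^sub>-\<^sub>1|\<close> times the seminorm of \<open>v\<^sub>j\<close>, and the Cauchy-Schwarz
  inequality shows that a multiplier vanishing beyond \<open>n\<close> is bounded on the Dirichlet space in terms of
  \<open>n\<close> times the sum of \<open>|c\<^sub>j - c\<^sub>j\<^sub>-\<^sub>1|\<^sup>2\<close> (\<open>hadamard_bound\<close>). For the Cesaro multipliers of order
  \<open>\<alpha>\<close> the differences are of size \<open>(n - j + 1) powr (\<alpha> - 1) / n powr \<alpha>\<close>, so this quantity is bounded
  in \<open>n\<close> because \<open>2 \<alpha> - 2 > - 1\<close> (\<open>cesaro_coeff_variation\<close>). For the multipliers
  \<open>\<rho>\<^sup>k\<close> a weighted telescoping gives the constant 1 (\<open>dilation_bound\<close>).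
  
  These bounds hold for polynomials and bounded weights. They extend to all weights and all
  holomorphic functions by truncating the weight, restricting to a smaller disc, approximating by
  Taylor polynomials there, and passing to the limit with Fatou's lemma (\<open>multiplier_bound\<close>).
  
  Finally, the dilates \<open>f(\<rho> z)\<close> converge to \<open>f\<close>: they converge pointwise and their energies do not
  exceed that of \<open>f\<close>, so the parallelogram law and Fatou's lemma give norm convergence
  (\<open>dilates_approximate\<close>). For a dilate the coefficients decay geometrically and the Cesaro means
  converge by dominated convergence of the coefficient sums (\<open>cesaro_sum_dilate_tendsto\<close>). The
  uniform bound on the Cesaro means then transfers the convergence to \<open>f\<close>.
\<close>

section \<open>Concave shift forms and Hadamard multipliers\<close>

definition hadamard :: "(nat \<Rightarrow> real) \<Rightarrow> complex poly \<Rightarrow> complex poly" where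
  "hadamard c p = (\<Sum>j\<le>degree p. monom (of_real (c j) * coeff p j) j)"

lemma coeff_hadamard [simp]: "coeff (hadamard c p) j = of_real (c j) * coeff p j"
  unfolding hadamard_def by (auto simp: coeff_sum if_distrib sum.delta coeff_eq_0)

lemma poly_shift_eq_const_plus_shift:
  "poly_shift i p = [:coeff p i:] + pCons 0 (poly_shift (Suc i) p)"
  by (rule poly_eqI) (auto simp: coeff_poly_shift coeff_pCons split: nat.split)

lemma poly_shift_eq_0: "(\<And>j. j \<ge> i \<Longrightarrow> coeff p j = 0) \<Longrightarrow> poly_shift i p = 0"
  by (rule poly_eqI) (auto simp: coeff_poly_shift)

text \<open>
  The constant terms of the two tails on the left cancel, which leaves a multiple of \<open>z\<close>. This
  recursion is what turns smoothness of the multiplier \<open>c\<close> into an estimate.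
\<close>

lemma hadamard_tail_difference:
  "poly_shift i (hadamard c p) - smult (of_real (c i)) (poly_shift i p)
     = pCons 0 (poly_shift (Suc i) (hadamard c p) - smult (of_real (c i)) (poly_shift (Suc i) p))"
  by (rule poly_eqI) (auto simp: coeff_poly_shift coeff_pCons split: nat.split)

text \<open>
  The two inequalities say that multiplication by \<open>z\<close> is expansive and that \<open>p \<mapsto> S p p\<close> is concave
  along the orbit \<open>p, z p, z\<^sup>2 p, ...\<close>. The form is only real-bilinear because the multipliers are real.
\<close>

locale concave_shift_form =
  fixes S :: "complex poly \<Rightarrow> complex poly \<Rightarrow> real"
  assumes sym: "S p q = S q p"
    and add_left: "S (p + q) r = S p r + S q r"
    and scale_left: "S (smult (of_real c) p) q = c * S p q"
    and const_left: "S [:a:] q = 0"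
    and expansive: "S p p \<le> S (pCons 0 p) (pCons 0 p)"
    and concave: "S (pCons 0 (pCons 0 p)) (pCons 0 (pCons 0 p)) + S p p
                    \<le> 2 * S (pCons 0 p) (pCons 0 p)"
begin

definition defect :: "complex poly \<Rightarrow> complex poly \<Rightarrow> real" where
  "defect p q = S (pCons 0 p) (pCons 0 q) - S p q"

definition defect_norm :: "complex poly \<Rightarrow> real" where
  "defect_norm p = sqrt (defect p p)"

lemma defect_sym: "defect p q = defect q p"
  unfolding defect_def using sym by metis

lemma defect_add_left: "defect (p + q) r = defect p r + defect q r"
proof -
  have "pCons 0 (p + q) = pCons 0 p + pCons 0 q" by simp
  then show ?thesis unfolding defect_def by (simp add: add_left del: add_pCons)
qed

lemma defect_scale_left: "defect (smult (of_real c) p) q = c * defect p q"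
proof -
  have "pCons 0 (smult (of_real c) p) = smult (of_real c) (pCons 0 p)" by simp
  then show ?thesis unfolding defect_def by (simp add: scale_left algebra_simps del: smult_pCons)
qed

lemma defect_add_right: "defect r (p + q) = defect r p + defect r q"
  by (metis defect_sym defect_add_left)

lemma defect_scale_right: "defect q (smult (of_real c) p) = c * defect q p"
  by (metis defect_sym defect_scale_left)

lemma defect_nonneg: "0 \<le> defect p p"
  unfolding defect_def using expansive[of p] by simp

lemma defect_shift_le: "defect (pCons 0 p) (pCons 0 p) \<le> defect p p"
  unfolding defect_def using concave[of p] by simp

lemma defect_combination:
  "defect (smult (of_real a) p + smult (of_real b) q) (smult (of_real a) p + smult (of_real b) q)
     = a\<^sup>2 * defect p p + 2 * a * b * defect p q + b\<^sup>2 * defect q q"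
  by (simp only: defect_add_left defect_add_right defect_scale_left defect_scale_right defect_sym[of q p])
     (simp add: algebra_simps power2_eq_square)

lemma defect_diff_scaled:
  "defect (p - smult (of_real c) q) (p - smult (of_real c) q) = defect p p - 2 * c * defect p q + c\<^sup>2 * defect q q"
  using defect_combination[of 1 p "-c" q] by simp

text \<open>
  The defect form is only semidefinite, so the usual argument of completing the square has to treat
  separately the case where both arguments have defect 0.
\<close>

lemma defect_cauchy_schwarz: "(defect p q)\<^sup>2 \<le> defect p p * defect q q"
proof -
  have *: "0 \<le> defect q q * (defect p p * defect q q - (defect p q)\<^sup>2)" for p q
    using defect_nonneg[of "smult (of_real (defect q q)) p + smult (of_real (- defect p q)) q"]
    by (simp only: defect_combination) (simp add: algebra_simps power2_eq_square)
  consider "defect q q > 0" | "defect p p > 0" | "defect p p = 0" "defect q q = 0"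
    using defect_nonneg[of p] defect_nonneg[of q] by linarith
  then show ?thesis
  proof cases
    case 1
    then show ?thesis using *[where p=p and q=q] by (simp add: zero_le_mult_iff)
  next
    case 2
    then show ?thesis using *[where p=q and q=p] unfolding defect_sym[of q p] by (simp add: zero_le_mult_iff mult.commute)
  next
    case 3
    then have "defect p q = 0"
      using defect_nonneg[of "smult (of_real 1) p + smult (of_real 1) q"]
        defect_nonneg[of "smult (of_real 1) p + smult (of_real (-1)) q"]
      unfolding defect_combination by simp
    then show ?thesis using 3 by simp
  qed
qed

lemma defect_norm_nonneg: "0 \<le> defect_norm p"
  unfolding defect_norm_def using defect_nonneg by simp

lemma defect_norm_power2: "(defect_norm p)\<^sup>2 = defect p p"
  unfolding defect_norm_def using defect_nonneg by simp

lemma defect_norm_triangle: "defect_norm (p + q) \<le> defect_norm p + defect_norm q"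
proof -
  have "defect p q \<le> defect_norm p * defect_norm q"
    using defect_cauchy_schwarz[of p q] defect_norm_nonneg[of p] defect_norm_nonneg[of q] defect_norm_power2[of p] defect_norm_power2[of q]
    by (metis abs_le_square_iff abs_of_nonneg abs_le_D1 mult_nonneg_nonneg power_mult_distrib)
  then have "(defect_norm (p + q))\<^sup>2 \<le> (defect_norm p + defect_norm q)\<^sup>2"
    using defect_combination[of 1 p 1 q] by (simp add: defect_norm_power2 power2_sum)
  then show ?thesis using defect_norm_nonneg by (simp add: power2_le_iff_abs_le)
qed

lemma defect_norm_scale: "defect_norm (smult (of_real c) p) = \<bar>c\<bar> * defect_norm p"
  unfolding defect_norm_def by (simp add: defect_scale_left defect_scale_right real_sqrt_mult flip: mult.assoc)

lemma defect_norm_shift_le: "defect_norm (pCons 0 p) \<le> defect_norm p"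
  unfolding defect_norm_def using defect_shift_le by simp

lemma defect_norm_zero: "defect_norm 0 = 0"
  using defect_norm_scale[of 0 0] by simp

text \<open>
  A tail is a constant plus \<open>z\<close> times the next tail, and the constant does not contribute to \<open>S\<close>;
  hence passing to the next tail costs exactly one value of the defect, and the sum telescopes.
\<close>

lemma form_eq_sum_tails:
  assumes "\<And>j. j > n \<Longrightarrow> coeff p j = 0"
  shows "S p p = (\<Sum>i<n. defect (poly_shift (Suc i) p) (poly_shift (Suc i) p))"
proof -
  have step: "S (poly_shift i p) (poly_shift i p)
     = defect (poly_shift (Suc i) p) (poly_shift (Suc i) p)
       + S (poly_shift (Suc i) p) (poly_shift (Suc i) p)" for i
  proof -
    have drop: "S ([:a:] + q) r = S q r" for a q r
      by (simp only: add_left const_left add_0)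
    have "S ([:a:] + q) ([:a:] + q) = S q q" for a q
      using drop[of a q "[:a:] + q"] sym[of q "[:a:] + q"] drop[of a q q] by linarith
    from this[of "coeff p i" "pCons 0 (poly_shift (Suc i) p)"] show ?thesis
      unfolding defect_def poly_shift_eq_const_plus_shift[of i p, symmetric] by simp
  qed
  have telescope: "S p p = (\<Sum>i<m. defect (poly_shift (Suc i) p) (poly_shift (Suc i) p))
          + S (poly_shift m p) (poly_shift m p)" for m
  proof (induction m)
    case 0
    have "poly_shift 0 p = p" by (rule poly_eqI) (simp add: coeff_poly_shift)
    then show ?case by simp
  next
    case (Suc m)
    then show ?case using step[of m] by (simp only: sum.lessThan_Suc)
  qed
  have "S (poly_shift n p) (poly_shift n p) = 0"
  proof -
    have "poly_shift n p = [:coeff p n:]"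
      using assms by (intro poly_eqI) (auto simp: coeff_poly_shift coeff_pCons split: nat.split)
    then show ?thesis using const_left by simp
  qed
  then show ?thesis using telescope[of n] by linarith
qed

text \<open>
  With \<open>y\<^sub>i\<close> the seminorm of \<open>w\<^sub>i - c\<^sub>i v\<^sub>i\<close>, the tail recursion and the contraction property give
  \<open>y\<^sub>i \<le> y\<^sub>i\<^sub>+\<^sub>1 + |c\<^sub>i\<^sub>+\<^sub>1 - c\<^sub>i| x\<^sub>i\<^sub>+\<^sub>1\<close>, where \<open>x\<^sub>i\<close> is the seminorm of \<open>v\<^sub>i\<close>. The Cauchy-Schwarz inequality bounds
  each of the \<open>n\<close> resulting sums by the same quantity, which produces the factor \<open>n\<close>; the constant 2
  comes from \<open>(a + b)\<^sup>2 \<le> 2 a\<^sup>2 + 2 b\<^sup>2\<close>.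
\<close>

theorem hadamard_bound:
  assumes c1: "\<And>j. \<bar>c j\<bar> \<le> 1" and c0: "\<And>j. j > n \<Longrightarrow> c j = 0"
  shows "S (hadamard c p) (hadamard c p)
           \<le> (2 + 2 * real n * (\<Sum>j\<le>n. (c (Suc j) - c j)\<^sup>2)) * S p p"
proof -
  define v where "v i = poly_shift i p" for i
  define w where "w i = poly_shift i (hadamard c p)" for i
  define x where "x i = defect_norm (v i)" for i
  define y where "y i = defect_norm (w i - smult (of_real (c i)) (v i))" for i
  define d where "d j = \<bar>c (Suc j) - c j\<bar>" for j
  define m where "m = max (Suc n) (degree p)"
  have y_step: "y i \<le> y (Suc i) + d i * x (Suc i)" for i
  proof -
    have "y i \<le> defect_norm (w (Suc i) - smult (of_real (c i)) (v (Suc i)))"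
      unfolding y_def w_def v_def hadamard_tail_difference by (rule defect_norm_shift_le)
    also have "w (Suc i) - smult (of_real (c i)) (v (Suc i))
        = (w (Suc i) - smult (of_real (c (Suc i))) (v (Suc i)))
          + smult (of_real (c (Suc i) - c i)) (v (Suc i))"
      by (simp add: smult_diff_left)
    finally show ?thesis
      using defect_norm_triangle[of "w (Suc i) - smult (of_real (c (Suc i))) (v (Suc i))"
          "smult (of_real (c (Suc i) - c i)) (v (Suc i))"]
      unfolding y_def d_def x_def defect_norm_scale by linarith
  qed
  have w0: "w i = 0" if "i > n" for i
    unfolding w_def using c0 that by (intro poly_shift_eq_0) auto
  have y_end: "y (Suc n) = 0"
    unfolding y_def using w0[of "Suc n"] c0 defect_norm_zero by simp
  have y_bound: "y i \<le> (\<Sum>j\<le>n. d j * x (Suc j))" if "i \<le> Suc n" for i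
  proof -
    have "y i \<le> (\<Sum>j\<in>{i..<Suc n}. d j * x (Suc j))"
      using that
    proof (induction rule: inc_induct)
      case base
      then show ?case using y_end by simp
    next
      case (step k)
      have "(\<Sum>j\<in>{k..<Suc n}. d j * x (Suc j)) = d k * x (Suc k) + (\<Sum>j\<in>{Suc k..<Suc n}. d j * x (Suc j))"
        using step.hyps by (intro sum.atLeast_Suc_lessThan) auto
      then show ?case using y_step[of k] step.IH by linarith
    qed
    also have "\<dots> \<le> (\<Sum>j\<le>n. d j * x (Suc j))"
      by (rule sum_mono2) (auto simp: d_def x_def defect_norm_nonneg)
    finally show ?thesis .
  qed
  have Sp: "S p p = (\<Sum>i<m. (x (Suc i))\<^sup>2)"
    unfolding x_def v_def defect_norm_power2 by (rule form_eq_sum_tails) (auto simp: m_def coeff_eq_0)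
  have Sh: "S (hadamard c p) (hadamard c p) = (\<Sum>i<n. (defect_norm (w (Suc i)))\<^sup>2)"
    unfolding w_def defect_norm_power2 by (rule form_eq_sum_tails) (auto simp: c0)
  define Q where "Q = (\<Sum>j\<le>n. (d j)\<^sup>2)"
  have le_Sp: "(\<Sum>i\<in>A. (x (Suc i))\<^sup>2) \<le> S p p" if "A \<subseteq> {..<m}" for A
    unfolding Sp using that by (intro sum_mono2) auto
  have Q0: "0 \<le> Q" unfolding Q_def by (simp add: sum_nonneg)
  have cs: "(\<Sum>j\<le>n. d j * x (Suc j))\<^sup>2 \<le> Q * S p p"
  proof -
    have "(\<Sum>j\<le>n. d j * x (Suc j))\<^sup>2 \<le> Q * (\<Sum>j\<le>n. (x (Suc j))\<^sup>2)"
      unfolding Q_def by (rule Cauchy_Schwarz_ineq_sum)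
    also have "\<dots> \<le> Q * S p p"
      using Q0 by (intro mult_left_mono le_Sp) (auto simp: m_def)
    finally show ?thesis .
  qed
  have each: "(defect_norm (w (Suc i)))\<^sup>2 \<le> 2 * (x (Suc i))\<^sup>2 + 2 * (Q * S p p)" if "i < n" for i
  proof -
    have "defect_norm (w (Suc i)) \<le> y (Suc i) + \<bar>c (Suc i)\<bar> * x (Suc i)"
      using defect_norm_triangle[of "w (Suc i) - smult (of_real (c (Suc i))) (v (Suc i))"
          "smult (of_real (c (Suc i))) (v (Suc i))"]
      unfolding y_def x_def by (simp add: defect_norm_scale)
    also have "\<dots> \<le> (\<Sum>j\<le>n. d j * x (Suc j)) + x (Suc i)"
      using y_bound[of "Suc i"] that c1[of "Suc i"] defect_norm_nonneg[of "v (Suc i)"]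
      by (intro add_mono mult_left_le_one_le) (auto simp: x_def)
    finally have "(defect_norm (w (Suc i)))\<^sup>2 \<le> ((\<Sum>j\<le>n. d j * x (Suc j)) + x (Suc i))\<^sup>2"
      using defect_norm_nonneg by (intro power_mono) auto
    also have "\<dots> \<le> 2 * (x (Suc i))\<^sup>2 + 2 * (\<Sum>j\<le>n. d j * x (Suc j))\<^sup>2"
      using sum_squares_ge_zero[of "(\<Sum>j\<le>n. d j * x (Suc j)) - x (Suc i)" 0]
      by (simp add: power2_eq_square algebra_simps)
    finally show ?thesis using cs by linarith
  qed
  have "S (hadamard c p) (hadamard c p) \<le> (\<Sum>i<n. 2 * (x (Suc i))\<^sup>2 + 2 * (Q * S p p))"
    unfolding Sh by (rule sum_mono) (use each in auto)
  also have "\<dots> = 2 * (\<Sum>i<n. (x (Suc i))\<^sup>2) + 2 * real n * Q * S p p"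
    by (simp add: sum.distrib sum_distrib_left)
  also have "\<dots> \<le> 2 * S p p + 2 * real n * Q * S p p"
    using le_Sp[of "{..<n}"] by (auto simp: m_def)
  finally show ?thesis unfolding Q_def d_def by (simp add: algebra_simps)
qed

text \<open>
  The general multiplier bound gives some constant here, but the approximation by dilates relies on
  the constant being 1. The tail recursion and the contraction property say that the defect of
  \<open>w\<^sub>i - \<rho>\<^sup>i v\<^sub>i\<close> is at most that of \<open>w\<^sub>i\<^sub>+\<^sub>1 - \<rho>\<^sup>i v\<^sub>i\<^sub>+\<^sub>1\<close>. After division by \<open>\<rho>\<^sup>i\<close> the mixed terms have a coefficient
  independent of \<open>i\<close>, so they cancel when these inequalities are added up.
\<close>

theorem dilation_bound:
  assumes \<rho>: "0 < \<rho>" "\<rho> < 1"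
  shows "S (hadamard (\<lambda>j. \<rho> ^ j) p) (hadamard (\<lambda>j. \<rho> ^ j) p) \<le> S p p"
proof -
  define c where "c j = \<rho> ^ j" for j :: nat
  define v where "v i = poly_shift i p" for i
  define w where "w i = poly_shift i (hadamard c p)" for i
  define V where "V i = defect (v i) (v i)" for i
  define W where "W i = defect (w i) (w i)" for i
  \<comment> \<open>Division by \<open>c i\<close> makes the mixed term of \<open>G i\<close> equal to \<open>- 2\<close> times the defect of \<open>w i\<close> and
    \<open>v i\<close>, with the same coefficient for all \<open>i\<close>.\<close>
  define G where "G i = inverse (c i) * defect (w i - smult (of_real (c i)) (v i)) (w i - smult (of_real (c i)) (v i))" for i
  define n where "n = degree p"
  have cpos: "c i > 0" for i unfolding c_def using \<rho> by simp
  have c_le: "c i \<le> 1" for i unfolding c_def using \<rho> by (simp add: power_le_one)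
  have G_eq: "G i = W i / c i - 2 * defect (w i) (v i) + c i * V i" for i
    unfolding G_def defect_diff_scaled V_def W_def using cpos[of i]
    by (simp add: field_simps power2_eq_square)
  have step: "G i + (1 - \<rho>) * (W (Suc i) / c (Suc i)) \<le> G (Suc i) + (1 - \<rho>) * (c i * V (Suc i))" for i
  proof -
    have "G i \<le> inverse (c i) * defect (w (Suc i) - smult (of_real (c i)) (v (Suc i)))
                                   (w (Suc i) - smult (of_real (c i)) (v (Suc i)))"
      unfolding G_def w_def v_def hadamard_tail_difference
      using cpos[of i] by (intro mult_left_mono defect_shift_le) auto
    also have "\<dots> = W (Suc i) / c i - 2 * defect (w (Suc i)) (v (Suc i)) + c i * V (Suc i)"
      unfolding defect_diff_scaled V_def W_def using cpos[of i]
      by (simp add: field_simps power2_eq_square)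
    also have "\<dots> = G (Suc i) - (1 - \<rho>) * (W (Suc i) / c (Suc i)) + (1 - \<rho>) * (c i * V (Suc i))"
      unfolding G_eq using \<rho> cpos[of i] by (simp add: c_def field_simps)
    finally show ?thesis by simp
  qed
  have "G 0 + (1 - \<rho>) * (\<Sum>i<m. W (Suc i) / c (Suc i))
          \<le> G m + (1 - \<rho>) * (\<Sum>i<m. c i * V (Suc i))" for m
  proof (induction m)
    case (Suc m)
    then show ?case using step[of m] by (simp add: algebra_simps)
  qed simp
  note sums = this[of "Suc n"]
  have "w (Suc n) = 0" "v (Suc n) = 0"
    unfolding w_def v_def n_def by (intro poly_shift_eq_0; auto simp: coeff_eq_0)+
  then have "G (Suc n) = 0"
    unfolding G_def using defect_scale_left[of 0 0 0] by simp
  moreover have "G 0 \<ge> 0"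
    unfolding G_def using cpos[of 0] defect_nonneg by simp
  ultimately have "(1 - \<rho>) * (\<Sum>i<Suc n. W (Suc i) / c (Suc i))
       \<le> (1 - \<rho>) * (\<Sum>i<Suc n. c i * V (Suc i))"
    using sums by linarith
  then have le: "(\<Sum>i<Suc n. W (Suc i) / c (Suc i)) \<le> (\<Sum>i<Suc n. c i * V (Suc i))"
    using \<rho> by simp
  have "S (hadamard c p) (hadamard c p) = (\<Sum>i<Suc n. W (Suc i))"
    unfolding W_def w_def by (rule form_eq_sum_tails) (auto simp: n_def coeff_eq_0)
  also have "\<dots> \<le> (\<Sum>i<Suc n. W (Suc i) / c (Suc i))"
  proof (rule sum_mono)
    fix i
    have "c (Suc i) * W (Suc i) \<le> W (Suc i)"
      using cpos[of "Suc i"] c_le[of "Suc i"] defect_nonneg[of "w (Suc i)"]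
      unfolding W_def by (intro mult_left_le_one_le) auto
    then show "W (Suc i) \<le> W (Suc i) / c (Suc i)"
      using cpos[of "Suc i"] by (simp add: pos_le_divide_eq mult.commute)
  qed
  also note le
  also have "(\<Sum>i<Suc n. c i * V (Suc i)) \<le> (\<Sum>i<Suc n. V (Suc i))"
    using c_le less_imp_le[OF cpos] defect_nonneg by (intro sum_mono mult_left_le_one_le) (auto simp: V_def)
  also have "\<dots> = S p p"
    unfolding V_def v_def by (rule form_eq_sum_tails[symmetric]) (auto simp: n_def coeff_eq_0)
  finally show ?thesis unfolding c_def .
qed

end

section \<open>Circle averages of polynomials\<close>

definition angle_measure :: "real measure" where
  "angle_measure = density lborel (indicator {0..2 * pi})"

definition disc_measure :: "complex measure" where
  "disc_measure = density lborel (indicator (ball 0 1))"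

lemma sets_angle_measure [measurable_cong, simp]: "sets angle_measure = sets borel"
  and space_angle_measure [simp]: "space angle_measure = UNIV"
  and sets_disc_measure [measurable_cong, simp]: "sets disc_measure = sets borel"
  and space_disc_measure [simp]: "space disc_measure = UNIV"
  by (simp_all add: angle_measure_def disc_measure_def)

lemma indicator_ball_measurable [measurable, simp]:
  "(indicator (ball 0 1) :: complex \<Rightarrow> 'b::{real_normed_algebra_1, second_countable_topology}) \<in> borel_measurable borel"
  "(indicator (ball 0 1) :: complex \<Rightarrow> ennreal) \<in> borel_measurable borel"
  by (intro borel_measurable_indicator; simp)+

lemma nn_integral_angle_measure:
  assumes "f \<in> borel_measurable borel"
  shows "(\<integral>\<^sup>+ t. f t \<partial>angle_measure) = (\<integral>\<^sup>+ t\<in>{0..2 * pi}. f t \<partial>lborel)"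
  unfolding angle_measure_def using assms by (subst nn_integral_density) (auto simp: mult.commute)

lemma nn_integral_disc_measure:
  assumes "f \<in> borel_measurable borel"
  shows "(\<integral>\<^sup>+ z. f z \<partial>disc_measure) = (\<integral>\<^sup>+ z\<in>ball 0 1. f z \<partial>lborel)"
  unfolding disc_measure_def using assms by (subst nn_integral_density) (auto simp: mult.commute)

lemma AE_disc: "AE z in disc_measure. z \<in> ball 0 1"
  unfolding disc_measure_def by (subst AE_density) (auto simp: indicator_def)

lemma emeasure_angle_measure: "emeasure angle_measure UNIV = ennreal (2 * pi)"
  unfolding angle_measure_def by (subst emeasure_density) auto

interpretation angle_measure: finite_measure angle_measure
  by standard (simp add: emeasure_angle_measure)

interpretation disc_measure: finite_measure disc_measure
proof
  have "emeasure disc_measure UNIV = emeasure lborel (ball 0 1 :: complex set)"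
    unfolding disc_measure_def by (subst emeasure_density) auto
  also have "\<dots> < \<infinity>"
    by (rule emeasure_bounded_finite) simp
  finally show "emeasure disc_measure (space disc_measure) \<noteq> \<infinity>" by simp
qed

lemma measure_angle_measure: "measure angle_measure UNIV = 2 * pi"
  unfolding measure_def emeasure_angle_measure by simp

lemma cis_measurable [measurable]: "cis \<in> borel_measurable borel"
  by (intro borel_measurable_continuous_onI continuous_intros)

lemma poly_measurable [measurable]: "poly p \<in> borel_measurable (borel :: complex measure)"
  by (intro borel_measurable_continuous_onI continuous_intros)

lemma continuous_on_cball_bounded:
  fixes f :: "complex \<Rightarrow> 'b::real_normed_vector"
  assumes "continuous_on (cball a r) f"
  shows "\<exists>B. \<forall>z\<in>cball a r. norm (f z) \<le> B"
proof -
  have "bounded (f ` cball a r)"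
    by (intro compact_imp_bounded compact_continuous_image assms compact_cball)
  then show ?thesis unfolding bounded_iff by blast
qed

lemma integral_cis_power:
  assumes "k > 0"
  shows "(\<integral>t. cis t ^ k \<partial>angle_measure) = 0"
proof -
  have "(\<integral>t. cis t ^ k \<partial>angle_measure) = (\<integral>t. indicator {0..2 * pi} t *\<^sub>R cis t ^ k \<partial>lborel)"
    unfolding angle_measure_def ennreal_indicator[symmetric] by (rule integral_density) auto
  also have "\<dots> = cis (2 * pi) ^ k / (\<i> * of_nat k) - cis 0 ^ k / (\<i> * of_nat k)"
  proof (rule integral_FTC_atLeastAtMost)
    fix t :: real
    have "((\<lambda>z. exp (\<i> * of_nat k * z) / (\<i> * of_nat k)) has_field_derivative exp (\<i> * of_nat k * of_real t))
            (at (of_real t))"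
      using assms by (auto intro!: derivative_eq_intros)
    then have "((\<lambda>z. exp (\<i> * of_nat k * of_real z) / (\<i> * of_nat k)) has_vector_derivative exp (\<i> * of_nat k * of_real t))
            (at t within {0..2*pi})"
      by (rule has_vector_derivative_real_field)
    moreover have "exp (\<i> * of_nat k * of_real x) = cis x ^ k" for x
      by (simp add: cis_conv_exp exp_of_nat_mult[symmetric] mult_ac)
    ultimately show "((\<lambda>z. cis z ^ k / (\<i> * of_nat k)) has_vector_derivative cis t ^ k)
            (at t within {0..2*pi})" by simp
  qed (auto intro!: continuous_intros)
  also have "\<dots> = 0" by simp
  finally show ?thesis .
qed

lemma poly_mean_value: "(\<integral>t. poly p (z - of_real h * cis t) \<partial>angle_measure) = 2 * pi * poly p z"
proof -
  define q where "q = pcompose p [:z, - of_real h:]"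
  have q: "poly p (z - of_real h * cis t) = (\<Sum>k\<le>degree q. coeff q k * cis t ^ k)" for t
    unfolding poly_altdef[symmetric] q_def by (simp add: poly_pcompose algebra_simps)
  have int: "integrable angle_measure (\<lambda>t. coeff q k * cis t ^ k)" for k
    by (rule angle_measure.integrable_const_bound[where B = "norm (coeff q k)"]) (auto simp: norm_mult norm_power)
  have "(\<integral>t. poly p (z - of_real h * cis t) \<partial>angle_measure) = (\<Sum>k\<le>degree q. coeff q k * (\<integral>t. cis t ^ k \<partial>angle_measure))"
    unfolding q using int by (subst Bochner_Integration.integral_sum) auto
  also have "\<dots> = (\<Sum>k\<le>degree q. if k = 0 then coeff q 0 * (2 * pi) else 0)"
    by (rule sum.cong) (auto simp: integral_cis_power measure_angle_measure scaleR_conv_of_real)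
  also have "\<dots> = 2 * pi * poly p z"
    by (simp add: q_def poly_0_coeff_0[symmetric] poly_pcompose)
  finally show ?thesis .
qed

lemma poly_increment_bound:
  fixes p :: "complex poly"
  obtains L where "L \<ge> 0"
    "\<And>z h t. norm z \<le> 1 \<Longrightarrow> 0 < h \<Longrightarrow> h \<le> 1 \<Longrightarrow> norm (poly p (z - of_real h * cis t) - poly p z) \<le> L * h"
proof -
  have "continuous_on (cball 0 2) (poly (pderiv p))"
    by (intro continuous_intros)
  from continuous_on_cball_bounded[OF this] obtain L where L: "\<And>z. z \<in> cball 0 2 \<Longrightarrow> norm (poly (pderiv p) z) \<le> L" by blast
  show ?thesis
  proof (rule that[of L])
    show "L \<ge> 0" using order_trans[OF norm_ge_zero L[of 0]] by simp
    fix z :: complex and h t :: real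
    assume a: "norm z \<le> 1" "0 < h" "h \<le> 1"
    have "norm (z - of_real h * cis t) \<le> 2"
      using norm_triangle_ineq4[of z "of_real h * cis t"] a by (simp add: norm_mult)
    then have "norm (poly p (z - of_real h * cis t) - poly p z) \<le> L * norm (z - of_real h * cis t - z)"
      using a by (intro field_differentiable_bound[where S = "cball 0 2" and f' = "poly (pderiv p)"] L
          convex_cball DERIV_subset[OF poly_DERIV]) auto
    then show "norm (poly p (z - of_real h * cis t) - poly p z) \<le> L * h"
      using a by (simp add: norm_mult)
  qed
qed

text \<open>
  Expanding \<open>|a|\<^sup>2 - |b|\<^sup>2 = |a - b|\<^sup>2 + 2 Re (cnj b (a - b))\<close>, the linear term averages to 0 by the
  mean value property.
\<close>

lemma poly_square_mean:
  "(\<integral>t. (norm (poly p (z - of_real h * cis t)))\<^sup>2 - (norm (poly p z))\<^sup>2 \<partial>angle_measure)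
     = (\<integral>t. (norm (poly p (z - of_real h * cis t) - poly p z))\<^sup>2 \<partial>angle_measure)"
proof -
  have bd: "\<exists>B. \<forall>t. norm (poly p (z - of_real h * cis t)) \<le> B"
  proof -
    have "continuous_on (cball z \<bar>h\<bar>) (poly p)"
      by (intro continuous_intros)
    from continuous_on_cball_bounded[OF this] obtain B where B: "\<And>w. w \<in> cball z \<bar>h\<bar> \<Longrightarrow> norm (poly p w) \<le> B" by blast
    show ?thesis by (intro exI[of _ B] allI B) (simp add: dist_norm norm_mult)
  qed
  then obtain B where B: "\<And>t. norm (poly p (z - of_real h * cis t)) \<le> B" by blast
  have i1: "integrable angle_measure (\<lambda>t. poly p (z - of_real h * cis t))"
    by (rule angle_measure.integrable_const_bound[where B = B]) (auto simp: B)
  have i2: "integrable angle_measure (\<lambda>t. (norm (poly p (z - of_real h * cis t) - poly p z))\<^sup>2)"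
  proof (rule angle_measure.integrable_const_bound[where B = "(B + norm (poly p z))\<^sup>2"], rule AE_I2)
    fix t show "norm ((norm (poly p (z - of_real h * cis t) - poly p z))\<^sup>2) \<le> (B + norm (poly p z))\<^sup>2"
      using norm_triangle_ineq4[of "poly p (z - of_real h * cis t)" "poly p z"] B[of t]
      by (simp add: power_mono)
  qed simp
  define l where "l w = Re (cnj (poly p z) * (w - poly p z))" for w
  have id: "(norm a)\<^sup>2 - (norm (poly p z))\<^sup>2 = (norm (a - poly p z))\<^sup>2 + 2 * l a" for a
    unfolding l_def cmod_power2 by (simp add: algebra_simps power2_eq_square)
  have i3: "integrable angle_measure (\<lambda>t. cnj (poly p z) * (poly p (z - of_real h * cis t) - poly p z))"
    using i1 by (intro integrable_mult_right Bochner_Integration.integrable_diff) auto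
  have "(\<integral>t. l (poly p (z - of_real h * cis t)) \<partial>angle_measure)
     = Re (\<integral>t. cnj (poly p z) * (poly p (z - of_real h * cis t) - poly p z) \<partial>angle_measure)"
    unfolding l_def by (rule integral_Re[OF i3])
  also have "(\<integral>t. cnj (poly p z) * (poly p (z - of_real h * cis t) - poly p z) \<partial>angle_measure) = 0"
    using i1 by (simp add: poly_mean_value measure_angle_measure scaleR_conv_of_real)
  finally have "(\<integral>t. l (poly p (z - of_real h * cis t)) \<partial>angle_measure) = 0" by simp
  moreover have "integrable angle_measure (\<lambda>t. l (poly p (z - of_real h * cis t)))"
    unfolding l_def by (rule integrable_Re[OF i3])
  ultimately show ?thesis unfolding id using i2 by simp
qed

text \<open>
  This is the identity between \<open>|p'|\<^sup>2\<close> and a quarter of the Laplacian of \<open>|p|\<^sup>2\<close>, with the Laplacian taken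
  as a limit of circle averages.
\<close>

lemma poly_square_mean_limit:
  assumes h: "h \<longlonglongrightarrow> 0" "\<And>n. 0 < h n" "\<And>n. h n \<le> 1" and z: "norm z \<le> 1"
  shows "(\<lambda>n. (\<integral>t. (norm (poly p (z - of_real (h n) * cis t) - poly p z))\<^sup>2 \<partial>angle_measure) / (h n)\<^sup>2)
            \<longlonglongrightarrow> 2 * pi * (norm (poly (pderiv p) z))\<^sup>2"
proof -
  obtain L where L: "L \<ge> 0" "\<And>z h t. norm z \<le> 1 \<Longrightarrow> 0 < h \<Longrightarrow> h \<le> 1 \<Longrightarrow> norm (poly p (z - of_real h * cis t) - poly p z) \<le> L * h"
    by (rule poly_increment_bound[of p]) (rule that; assumption)
  have "(\<lambda>n. (\<integral>t. (norm (poly p (z - of_real (h n) * cis t) - poly p z) / h n)\<^sup>2 \<partial>angle_measure))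
     \<longlonglongrightarrow> (\<integral>t. (norm (poly (pderiv p) z))\<^sup>2 \<partial>angle_measure)"
  proof (rule integral_dominated_convergence[where w = "\<lambda>_. L\<^sup>2"])
    show "AE t in angle_measure. (\<lambda>n. (norm (poly p (z - of_real (h n) * cis t) - poly p z) / h n)\<^sup>2)
            \<longlonglongrightarrow> (norm (poly (pderiv p) z))\<^sup>2"
    proof (rule AE_I2)
      fix t
      have hn0: "h n \<noteq> 0" for n using h(2)[of n] by simp
      have lim: "filterlim (\<lambda>n. - of_real (h n) * cis t) (at 0) sequentially"
        unfolding filterlim_at
      proof
        have "(\<lambda>n. - of_real (h n) * cis t) \<longlonglongrightarrow> - of_real 0 * cis t"
          by (intro tendsto_intros h)
        then show "(\<lambda>n. - of_real (h n) * cis t) \<longlonglongrightarrow> 0" by simp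
        show "\<forall>\<^sub>F n in sequentially. - of_real (h n) * cis t \<in> UNIV \<and> - of_real (h n) * cis t \<noteq> 0"
          using hn0 by (intro always_eventually allI) simp
      qed
      have "((\<lambda>w. (poly p (z + w) - poly p z) / w) \<longlongrightarrow> poly (pderiv p) z) (at 0)"
        using poly_DERIV[of p z] unfolding DERIV_def .
      from tendsto_power[OF tendsto_norm[OF filterlim_compose[OF this lim]], of 2]
      show "(\<lambda>n. (norm (poly p (z - of_real (h n) * cis t) - poly p z) / h n)\<^sup>2)
            \<longlonglongrightarrow> (norm (poly (pderiv p) z))\<^sup>2"
        using h(2) by (simp add: norm_divide norm_mult power_divide abs_of_pos)
    qed
    show "AE t in angle_measure. norm ((norm (poly p (z - of_real (h n) * cis t) - poly p z) / h n)\<^sup>2) \<le> L\<^sup>2" for n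
    proof (rule AE_I2)
      fix t
      have "norm (poly p (z - of_real (h n) * cis t) - poly p z) / h n \<le> L"
        using L(2)[OF z h(2) h(3), of n t] h(2)[of n] by (simp add: field_simps)
      then have "(norm (poly p (z - of_real (h n) * cis t) - poly p z) / h n)\<^sup>2 \<le> L\<^sup>2"
        using h(2)[of n] by (intro power_mono) auto
      then show "norm ((norm (poly p (z - of_real (h n) * cis t) - poly p z) / h n)\<^sup>2) \<le> L\<^sup>2"
        by simp
    qed
  qed auto
  then show ?thesis by (simp add: power_divide measure_angle_measure)
qed

lemma poly_square_mean_bounded:
  fixes p :: "complex poly"
  shows "\<exists>B. \<forall>z h. norm z \<le> 1 \<longrightarrow> 0 < h \<longrightarrow> h \<le> 1 \<longrightarrow>
     \<bar>(\<integral>t. (norm (poly p (z - of_real h * cis t) - poly p z))\<^sup>2 \<partial>angle_measure) / h\<^sup>2\<bar> \<le> B"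
proof -
  obtain L where L: "L \<ge> 0" "\<And>z h t. norm z \<le> 1 \<Longrightarrow> 0 < h \<Longrightarrow> h \<le> 1 \<Longrightarrow> norm (poly p (z - of_real h * cis t) - poly p z) \<le> L * h"
    by (rule poly_increment_bound[of p]) (rule that; assumption)
  show ?thesis
  proof (intro exI[of _ "2 * pi * L\<^sup>2"] allI impI)
    fix z :: complex and h :: real
    assume a: "norm z \<le> 1" "0 < h" "h \<le> 1"
    have le: "(norm (poly p (z - of_real h * cis t) - poly p z))\<^sup>2 \<le> (L * h)\<^sup>2" for t
      by (rule power_mono[OF L(2)[OF a]]) auto
    have "(\<integral>t. (norm (poly p (z - of_real h * cis t) - poly p z))\<^sup>2 \<partial>angle_measure) \<le> (\<integral>t. (L * h)\<^sup>2 \<partial>angle_measure)"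
      by (intro integral_mono le angle_measure.integrable_const_bound[where B = "(L*h)\<^sup>2"]) (auto simp: le)
    moreover have "0 \<le> (\<integral>t. (norm (poly p (z - of_real h * cis t) - poly p z))\<^sup>2 \<partial>angle_measure)"
      by simp
    ultimately show "\<bar>(\<integral>t. (norm (poly p (z - of_real h * cis t) - poly p z))\<^sup>2 \<partial>angle_measure) / h\<^sup>2\<bar> \<le> 2 * pi * L\<^sup>2"
      using a by (simp add: measure_angle_measure field_simps power_mult_distrib)
  qed
qed

section \<open>Testing superharmonic functions\<close>

text \<open>
  The weights for which all integrals below are finite. The bounds on \<open>u\<close> are required on the whole
  plane so that convolutions with functions supported in the disc make sense globally, while the
  super-mean-value inequality concerns only circles inside the disc.
\<close>

definition bounded_superharmonic :: "(complex \<Rightarrow> real) \<Rightarrow> bool" where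
  "bounded_superharmonic u \<longleftrightarrow>
     u \<in> borel_measurable borel \<and> (\<exists>M. \<forall>z. 0 \<le> u z \<and> u z \<le> M) \<and>
     (\<forall>w r. 0 < r \<longrightarrow> cball w r \<subseteq> ball 0 1 \<longrightarrow>
        (\<integral>\<^sup>+ t. ennreal (u (w + of_real r * cis t)) \<partial>angle_measure) \<le> ennreal (2 * pi * u w))"

lemma nn_integral_translate:
  fixes f :: "complex \<Rightarrow> ennreal"
  assumes "f \<in> borel_measurable borel"
  shows "(\<integral>\<^sup>+ z. f (a + z) \<partial>lborel) = (\<integral>\<^sup>+ z. f z \<partial>lborel)"
proof -
  have "(\<integral>\<^sup>+ z. f z \<partial>lborel) = (\<integral>\<^sup>+ z. f z \<partial>distr lborel borel ((+) a))"
    by (simp add: lborel_distr_plus)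
  also have "\<dots> = (\<integral>\<^sup>+ z. f (a + z) \<partial>lborel)"
    using assms by (subst nn_integral_distr) auto
  finally show ?thesis by simp
qed

text \<open>
  Averaging over circles is self-adjoint with respect to area measure, so the average can be moved
  from \<open>\<psi>\<close> to \<open>u\<close>, where superharmonicity applies.
\<close>

lemma smoothing_decreases_pairing:
  fixes \<psi> :: "complex \<Rightarrow> real"
  assumes u: "bounded_superharmonic u" and h: "0 < h"
    and \<psi>: "\<psi> \<in> borel_measurable borel" "\<And>z. 0 \<le> \<psi> z"
    and supp: "\<And>z. \<psi> z \<noteq> 0 \<Longrightarrow> cball z h \<subseteq> ball 0 1"
  shows "(\<integral>\<^sup>+ z. ennreal (u z) * (\<integral>\<^sup>+ t. ennreal (\<psi> (z - of_real h * cis t)) \<partial>angle_measure) \<partial>lborel)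
           \<le> (\<integral>\<^sup>+ z. ennreal (2 * pi * u z * \<psi> z) \<partial>lborel)"
proof -
  interpret pair_sigma_finite lborel angle_measure ..
  have [measurable]: "u \<in> borel_measurable borel" "\<psi> \<in> borel_measurable borel"
    using u \<psi> by (auto simp: bounded_superharmonic_def)
  have u0: "0 \<le> u z" for z using u by (auto simp: bounded_superharmonic_def)
  have "(\<integral>\<^sup>+ z. ennreal (u z) * (\<integral>\<^sup>+ t. ennreal (\<psi> (z - of_real h * cis t)) \<partial>angle_measure) \<partial>lborel)
      = (\<integral>\<^sup>+ z. (\<integral>\<^sup>+ t. ennreal (u z) * ennreal (\<psi> (z - of_real h * cis t)) \<partial>angle_measure) \<partial>lborel)"
    by (intro nn_integral_cong nn_integral_cmult[symmetric]) measurable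
  also have "\<dots> = (\<integral>\<^sup>+ t. (\<integral>\<^sup>+ z. ennreal (u z) * ennreal (\<psi> (z - of_real h * cis t)) \<partial>lborel) \<partial>angle_measure)"
    by (rule Fubini'[symmetric]) measurable
  also have "\<dots> = (\<integral>\<^sup>+ t. (\<integral>\<^sup>+ w. ennreal (u (w + of_real h * cis t)) * ennreal (\<psi> w) \<partial>lborel) \<partial>angle_measure)"
  proof (rule nn_integral_cong)
    fix t
    show "(\<integral>\<^sup>+ z. ennreal (u z) * ennreal (\<psi> (z - of_real h * cis t)) \<partial>lborel)
        = (\<integral>\<^sup>+ w. ennreal (u (w + of_real h * cis t)) * ennreal (\<psi> w) \<partial>lborel)"
      by (subst nn_integral_translate[symmetric, where a = "of_real h * cis t"]) (auto simp: add_ac)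
  qed
  also have "\<dots> = (\<integral>\<^sup>+ w. (\<integral>\<^sup>+ t. ennreal (u (w + of_real h * cis t)) * ennreal (\<psi> w) \<partial>angle_measure) \<partial>lborel)"
    by (rule Fubini') measurable
  also have "\<dots> \<le> (\<integral>\<^sup>+ w. ennreal (2 * pi * u w * \<psi> w) \<partial>lborel)"
  proof (rule nn_integral_mono)
    fix w
    have "(\<integral>\<^sup>+ t. ennreal (u (w + of_real h * cis t)) * ennreal (\<psi> w) \<partial>angle_measure)
         = (\<integral>\<^sup>+ t. ennreal (u (w + of_real h * cis t)) \<partial>angle_measure) * ennreal (\<psi> w)"
      by (rule nn_integral_multc) measurable
    also have "\<dots> \<le> ennreal (2 * pi * u w) * ennreal (\<psi> w)"
    proof (cases "\<psi> w = 0")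
      case False
      then show ?thesis
        using u h supp unfolding bounded_superharmonic_def by (intro mult_right_mono) auto
    qed simp
    also have "\<dots> = ennreal (2 * pi * u w * \<psi> w)"
      using u0 \<psi> by (simp add: ennreal_mult)
    finally show "(\<integral>\<^sup>+ t. ennreal (u (w + of_real h * cis t)) * ennreal (\<psi> w) \<partial>angle_measure)
         \<le> ennreal (2 * pi * u w * \<psi> w)" .
  qed
  finally show ?thesis .
qed


lemma disc_integrable:
  fixes f :: "complex \<Rightarrow> 'b::{banach, second_countable_topology}"
  assumes "f \<in> borel_measurable borel" "\<And>z. norm z < 1 \<Longrightarrow> norm (f z) \<le> B"
  shows "integrable disc_measure f"
proof (rule disc_measure.integrable_const_bound[where B = B])
  show "AE z in disc_measure. norm (f z) \<le> B"
    using AE_disc by (rule AE_mp) (auto intro!: AE_I2 assms)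
qed (use assms in simp)

text \<open>
  The function \<open>\<phi>\<close> is not compactly supported in the disc, so the previous lemma is applied to the
  positive part of \<open>\<phi> - \<epsilon>\<close>, set to 0 outside the disc, which is. On the set where \<open>\<phi> \<ge> \<epsilon>\<close> its circle average exceeds its value by
  at least as much as that of \<open>\<phi>\<close>, because a positive part dominates the function.
\<close>

lemma superharmonic_test_increment:
  fixes \<phi> :: "complex \<Rightarrow> real"
  assumes u: "bounded_superharmonic u" and \<phi>: "continuous_on UNIV \<phi>"
    and \<phi>0: "\<And>z. norm z = 1 \<Longrightarrow> \<phi> z = 0" and \<epsilon>: "0 < \<epsilon>"
  obtains h0 where "0 < h0"
    "\<And>h. 0 < h \<Longrightarrow> h < h0 \<Longrightarrow>
       (\<integral>z. indicator {z \<in> ball 0 1. \<epsilon> \<le> \<phi> z} z * u z * (\<integral>t. \<phi> (z - of_real h * cis t) - \<phi> z \<partial>angle_measure) \<partial>disc_measure) \<le> 0"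
proof -
  define K where "K = {z \<in> ball 0 1. \<epsilon> \<le> \<phi> z}"
  have K_eq: "K = cball 0 1 \<inter> {z. \<epsilon> \<le> \<phi> z}"
    using \<phi>0 \<epsilon> by (auto simp: K_def less_le)
  have "closed {z. \<epsilon> \<le> \<phi> z}"
    by (intro closed_Collect_le continuous_on_const \<phi>)
  then have K: "compact K" unfolding K_eq by (intro compact_Int_closed compact_cball)
  have Km [measurable]: "K \<in> sets borel"
    using K by (simp add: borel_closed compact_imp_closed)
  have [measurable]: "\<phi> \<in> borel_measurable borel"
    using \<phi> by (rule borel_measurable_continuous_onI)
  obtain M where um [measurable]: "u \<in> borel_measurable borel" and u0: "\<And>z. 0 \<le> u z" and uM: "\<And>z. u z \<le> M"
    using u by (auto simp: bounded_superharmonic_def)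
  obtain h0 where h0: "0 < h0" "(\<Union>z\<in>K. cball z h0) \<subseteq> ball 0 1"
    using compact_subset_open_imp_cball_epsilon_subset[OF K open_ball[of 0 1]] unfolding K_def by blast
  obtain B where B: "\<And>z. z \<in> K \<Longrightarrow> \<bar>\<phi> z\<bar> \<le> B"
  proof -
    have "bounded (\<phi> ` K)"
      by (intro compact_imp_bounded compact_continuous_image K continuous_on_subset[OF \<phi>]) simp
    then show ?thesis using that by (auto simp: bounded_iff)
  qed
  define \<psi> where "\<psi> z = indicator K z * (\<phi> z - \<epsilon>)" for z
  have \<psi>m [measurable]: "\<psi> \<in> borel_measurable borel" unfolding \<psi>_def by measurable
  have \<psi>0: "0 \<le> \<psi> z" for z unfolding \<psi>_def K_def by (simp add: indicator_def)
  have \<psi>B: "\<psi> z \<le> \<bar>B\<bar>" for z using B[of z] \<epsilon> unfolding \<psi>_def by (auto simp: indicator_def)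
  show ?thesis
  proof (rule that[OF h0(1)])
    fix h assume h: "0 < h" "h < h0"
    have supp: "cball z h \<subseteq> ball 0 1" if "z \<in> K" for z
    proof -
      have "cball z h \<subseteq> cball z h0" using h by (intro subset_cball) simp
      then show ?thesis using h0(2) that by blast
    qed
    define J where "J z = (\<integral>t. \<psi> (z - of_real h * cis t) \<partial>angle_measure)" for z
    have J_int: "integrable angle_measure (\<lambda>t. \<psi> (z - of_real h * cis t))" for z
      by (rule angle_measure.integrable_const_bound[where B = "\<bar>B\<bar>"]) (auto simp: \<psi>0 \<psi>B)
    have Jm [measurable]: "J \<in> borel_measurable borel"
    proof -
      have "(\<lambda>z. \<integral>t. \<psi> (z - of_real h * cis t) \<partial>angle_measure) \<in> borel_measurable borel"
        by (rule angle_measure.borel_measurable_lebesgue_integral) measurable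
      then show ?thesis unfolding J_def .
    qed
    have J0: "0 \<le> J z" for z unfolding J_def by (simp add: \<psi>0)
    have JB: "J z \<le> 2 * pi * \<bar>B\<bar>" for z
    proof -
      have "J z \<le> (\<integral>t. \<bar>B\<bar> \<partial>angle_measure)" unfolding J_def by (intro integral_mono J_int) (auto simp: \<psi>B)
      then show ?thesis by (simp add: measure_angle_measure)
    qed
    define a where "a z = indicator K z * u z * J z" for z
    define b where "b z = indicator K z * (2 * pi * u z * \<psi> z)" for z
    have a_int: "integrable disc_measure a"
      unfolding a_def
    proof (rule disc_integrable[where B = "\<bar>M\<bar> * (2 * pi * \<bar>B\<bar>)"])
      fix z :: complex
      have "\<bar>u z\<bar> * \<bar>J z\<bar> \<le> \<bar>M\<bar> * (2 * pi * \<bar>B\<bar>)"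
        using u0[of z] uM[of z] J0[of z] JB[of z] by (intro mult_mono) auto
      then show "norm (indicator K z * u z * J z) \<le> \<bar>M\<bar> * (2 * pi * \<bar>B\<bar>)"
        by (auto simp: indicator_def abs_mult)
    qed measurable
    have b_int: "integrable disc_measure b"
      unfolding b_def
    proof (rule disc_integrable[where B = "2 * pi * \<bar>M\<bar> * \<bar>B\<bar>"])
      fix z :: complex
      have "2 * pi * \<bar>u z\<bar> * \<bar>\<psi> z\<bar> \<le> 2 * pi * \<bar>M\<bar> * \<bar>B\<bar>"
        using u0[of z] uM[of z] \<psi>0[of z] \<psi>B[of z] by (intro mult_mono) auto
      then show "norm (indicator K z * (2 * pi * u z * \<psi> z)) \<le> 2 * pi * \<bar>M\<bar> * \<bar>B\<bar>"
        by (auto simp: indicator_def abs_mult)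
    qed measurable
    have a0: "0 \<le> a z" and b0: "0 \<le> b z" for z
      using u0 J0 \<psi>0 by (auto simp: a_def b_def)
    have "ennreal (\<integral>z. a z \<partial>disc_measure) = (\<integral>\<^sup>+ z. ennreal (a z) \<partial>disc_measure)"
      by (rule nn_integral_eq_integral[symmetric]) (auto simp: a_int a0)
    also have "\<dots> = (\<integral>\<^sup>+ z\<in>ball 0 1. ennreal (a z) \<partial>lborel)"
      by (rule nn_integral_disc_measure) (simp add: a_def)
    also have "\<dots> \<le> (\<integral>\<^sup>+ z. ennreal (u z) * (\<integral>\<^sup>+ t. ennreal (\<psi> (z - of_real h * cis t)) \<partial>angle_measure) \<partial>lborel)"
    proof (rule nn_integral_mono)
      fix z
      have "(\<integral>\<^sup>+ t. ennreal (\<psi> (z - of_real h * cis t)) \<partial>angle_measure) = ennreal (J z)"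
        unfolding J_def by (rule nn_integral_eq_integral[OF J_int]) (simp add: \<psi>0)
      then show "ennreal (a z) * indicator (ball 0 1) z \<le>
          ennreal (u z) * (\<integral>\<^sup>+ t. ennreal (\<psi> (z - of_real h * cis t)) \<partial>angle_measure)"
        using u0[of z] J0[of z] by (auto simp: a_def indicator_def ennreal_mult)
    qed
    also have "\<dots> \<le> (\<integral>\<^sup>+ z. ennreal (2 * pi * u z * \<psi> z) \<partial>lborel)"
      by (rule smoothing_decreases_pairing[OF u h(1)])
        (use \<psi>0 \<psi>m supp in \<open>auto simp: \<psi>_def indicator_def split: if_splits\<close>)
    also have "\<dots> = (\<integral>\<^sup>+ z\<in>ball 0 1. ennreal (b z) \<partial>lborel)"
      by (rule nn_integral_cong) (auto simp: b_def \<psi>_def K_def indicator_def)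
    also have "\<dots> = (\<integral>\<^sup>+ z. ennreal (b z) \<partial>disc_measure)"
      by (rule nn_integral_disc_measure[symmetric]) (simp add: b_def)
    also have "\<dots> = ennreal (\<integral>z. b z \<partial>disc_measure)"
      by (rule nn_integral_eq_integral) (auto simp: b_int b0)
    finally have ab: "(\<integral>z. a z \<partial>disc_measure) \<le> (\<integral>z. b z \<partial>disc_measure)"
      using b0 by (simp add: ennreal_le_iff integral_nonneg_AE)
    define c where "c z = indicator K z * u z * (\<integral>t. \<phi> (z - of_real h * cis t) - \<phi> z \<partial>angle_measure)" for z
    have c_le: "c z \<le> a z - b z" for z
    proof (cases "z \<in> K")
      case True
      have "(\<integral>t. \<phi> (z - of_real h * cis t) - \<phi> z \<partial>angle_measure) \<le> (\<integral>t. \<psi> (z - of_real h * cis t) - \<psi> z \<partial>angle_measure)"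
      proof (rule integral_mono)
        obtain D where D: "\<And>w. w \<in> cball z h \<Longrightarrow> norm (\<phi> w) \<le> D"
          using continuous_on_cball_bounded[OF continuous_on_subset[OF \<phi> subset_UNIV], of z h] by blast
        have "norm (\<phi> (z - of_real h * cis t)) \<le> D" for t
          using h by (intro D) (simp add: dist_norm norm_mult)
        then have "integrable angle_measure (\<lambda>t. \<phi> (z - of_real h * cis t))"
          by (intro angle_measure.integrable_const_bound[where B = D]) auto
        then show "integrable angle_measure (\<lambda>t. \<phi> (z - of_real h * cis t) - \<phi> z)" by simp
        show "integrable angle_measure (\<lambda>t. \<psi> (z - of_real h * cis t) - \<psi> z)" using J_int by simp
        fix t
        have "z - of_real h * cis t \<in> cball z h" using h by (simp add: dist_norm norm_mult)
        then have "z - of_real h * cis t \<in> ball 0 1" using supp[OF True] by blast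
        then have "\<phi> (z - of_real h * cis t) - \<epsilon> \<le> \<psi> (z - of_real h * cis t)"
          by (auto simp: \<psi>_def K_def indicator_def)
        moreover have "\<psi> z = \<phi> z - \<epsilon>" using True by (simp add: \<psi>_def)
        ultimately show "\<phi> (z - of_real h * cis t) - \<phi> z \<le> \<psi> (z - of_real h * cis t) - \<psi> z" by simp
      qed
      also have "\<dots> = J z - 2 * pi * \<psi> z"
        unfolding J_def using J_int by (simp add: measure_angle_measure)
      finally have "u z * (\<integral>t. \<phi> (z - of_real h * cis t) - \<phi> z \<partial>angle_measure) \<le> u z * (J z - 2 * pi * \<psi> z)"
        using u0 by (rule mult_left_mono)
      then show ?thesis using True by (simp add: a_def b_def c_def algebra_simps)
    qed (simp add: a_def b_def c_def)
    have "(\<integral>z. c z \<partial>disc_measure) \<le> 0"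
    proof (cases "integrable disc_measure c")
      case True
      then have "(\<integral>z. c z \<partial>disc_measure) \<le> (\<integral>z. a z - b z \<partial>disc_measure)"
        using a_int b_int c_le by (intro integral_mono) auto
      then show ?thesis using a_int b_int ab by simp
    qed (simp add: not_integrable_integral_eq)
    then show "(\<integral>z. indicator {z \<in> ball 0 1. \<epsilon> \<le> \<phi> z} z * u z * (\<integral>t. \<phi> (z - of_real h * cis t) - \<phi> z \<partial>angle_measure) \<partial>disc_measure) \<le> 0"
      unfolding c_def K_def .
  qed
qed

text \<open>
  Morally this is \<open>\<integral> u \<Delta>\<phi> \<le> 0\<close> for a function \<open>\<phi>\<close> vanishing on the circle, integrated over the part of
  the disc where \<open>\<phi>\<close> is positive. The increments of the previous lemma, divided by \<open>h\<^sup>2\<close>, converge to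
  a multiple of the Laplacian as \<open>h\<close> tends to 0; then \<open>\<epsilon>\<close> tends to 0.
\<close>

theorem superharmonic_test_inequality:
  fixes c :: "'i \<Rightarrow> real" and F :: "'i \<Rightarrow> complex poly"
  assumes u: "bounded_superharmonic u" and I: "finite I"
    and \<phi>0: "\<And>z. norm z = 1 \<Longrightarrow> (\<Sum>l\<in>I. c l * (norm (poly (F l) z))\<^sup>2) = 0"
  shows "(\<integral>z. indicator {z. 0 < (\<Sum>l\<in>I. c l * (norm (poly (F l) z))\<^sup>2)} z *
              (u z * (\<Sum>l\<in>I. c l * (norm (poly (pderiv (F l)) z))\<^sup>2)) \<partial>disc_measure) \<le> 0"
proof -
  define \<phi> where "\<phi> z = (\<Sum>l\<in>I. c l * (norm (poly (F l) z))\<^sup>2)" for z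
  define \<Lambda> where "\<Lambda> z = (\<Sum>l\<in>I. c l * (norm (poly (pderiv (F l)) z))\<^sup>2)" for z
  have \<phi>c: "continuous_on UNIV \<phi>" unfolding \<phi>_def by (intro continuous_intros)
  have \<phi>m [measurable]: "\<phi> \<in> borel_measurable borel"
    using \<phi>c by (rule borel_measurable_continuous_onI)
  have \<Lambda>c: "continuous_on UNIV \<Lambda>" unfolding \<Lambda>_def by (intro continuous_intros)
  have \<Lambda>m [measurable]: "\<Lambda> \<in> borel_measurable borel"
    using \<Lambda>c by (rule borel_measurable_continuous_onI)
  obtain M where um [measurable]: "u \<in> borel_measurable borel" and u0: "\<And>z. 0 \<le> u z" and uM: "\<And>z. u z \<le> M"
    using u by (auto simp: bounded_superharmonic_def)
  obtain B where "\<And>z. z \<in> cball 0 1 \<Longrightarrow> norm (\<Lambda> z) \<le> B"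
    using continuous_on_cball_bounded[OF continuous_on_subset[OF \<Lambda>c subset_UNIV], of 0 1] by blast
  then have B: "\<bar>\<Lambda> z\<bar> \<le> B" if "norm z \<le> 1" for z
    using that by simp
  have Km [measurable]: "{z \<in> ball 0 1. \<epsilon> \<le> \<phi> z} \<in> sets borel" for \<epsilon>
  proof -
    have "{z \<in> ball 0 1. \<epsilon> \<le> \<phi> z} = ball 0 1 \<inter> {z. \<epsilon> \<le> \<phi> z}" by auto
    moreover have "closed {z. \<epsilon> \<le> \<phi> z}" by (intro closed_Collect_le continuous_on_const \<phi>c)
    ultimately show ?thesis by simp
  qed
  have truncated: "(\<integral>z. indicator {z \<in> ball 0 1. \<epsilon> \<le> \<phi> z} z * u z * (2 * pi * \<Lambda> z) \<partial>disc_measure) \<le> 0" if \<epsilon>: "0 < \<epsilon>" for \<epsilon>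
  proof -
    define K where "K = {z \<in> ball 0 1. \<epsilon> \<le> \<phi> z}"
    have [measurable]: "K \<in> sets borel" unfolding K_def by (rule Km)
    obtain h0 where h0: "0 < h0" and neg: "\<And>h. 0 < h \<Longrightarrow> h < h0 \<Longrightarrow>
       (\<integral>z. indicator K z * u z * (\<integral>t. \<phi> (z - of_real h * cis t) - \<phi> z \<partial>angle_measure) \<partial>disc_measure) \<le> 0"
      using superharmonic_test_increment[OF u \<phi>c _ \<epsilon>] \<phi>0 unfolding K_def \<phi>_def by blast
    \<comment> \<open>A null sequence of radii that stays below 1 and below \<open>h0\<close>.\<close>
    define h where "h n = min 1 (h0 / 2) * inverse (real (Suc n))" for n
    have h_pos: "0 < h n" for n using h0 by (simp add: h_def)
    have h_le: "h n \<le> min 1 (h0 / 2)" for n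
      unfolding h_def using h0 by (intro mult_left_le) (auto simp: field_simps)
    have h_lim: "h \<longlonglongrightarrow> 0"
      using tendsto_mult[OF tendsto_const LIMSEQ_inverse_real_of_nat, of "min 1 (h0 / 2)"]
      unfolding h_def by simp
    have h1: "h n \<le> 1" "h n < h0" for n using h_le[of n] h0 by auto
    define E where "E p r z = (\<integral>t. (norm (poly p (z - of_real r * cis t) - poly p z))\<^sup>2 \<partial>angle_measure) / r\<^sup>2"
      for p :: "complex poly" and r :: real and z :: complex
    have E: "(\<integral>t. \<phi> (z - of_real r * cis t) - \<phi> z \<partial>angle_measure) = r\<^sup>2 * (\<Sum>l\<in>I. c l * E (F l) r z)" if "r > 0" for r z
    proof -
      have int: "integrable angle_measure (\<lambda>t. c l * ((norm (poly (F l) (z - of_real r * cis t)))\<^sup>2 - (norm (poly (F l) z))\<^sup>2))" for l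
      proof -
        have "continuous_on (cball z r) (poly (F l))"
          by (intro continuous_intros)
        from continuous_on_cball_bounded[OF this] obtain D where D: "\<And>w. w \<in> cball z r \<Longrightarrow> norm (poly (F l) w) \<le> D" by blast
        have "norm (poly (F l) (z - of_real r * cis t)) \<le> D" for t
          using that by (intro D) (simp add: dist_norm norm_mult)
        then have "integrable angle_measure (\<lambda>t. (norm (poly (F l) (z - of_real r * cis t)))\<^sup>2)"
          by (intro angle_measure.integrable_const_bound[where B = "D\<^sup>2"]) (auto intro!: power_mono)
        then show ?thesis by simp
      qed
      have "(\<integral>t. \<phi> (z - of_real r * cis t) - \<phi> z \<partial>angle_measure)
        = (\<integral>t. (\<Sum>l\<in>I. c l * ((norm (poly (F l) (z - of_real r * cis t)))\<^sup>2 - (norm (poly (F l) z))\<^sup>2)) \<partial>angle_measure)"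
        unfolding \<phi>_def by (simp add: sum_subtractf right_diff_distrib)
      also have "\<dots> = (\<Sum>l\<in>I. c l * (\<integral>t. (norm (poly (F l) (z - of_real r * cis t)))\<^sup>2 - (norm (poly (F l) z))\<^sup>2 \<partial>angle_measure))"
        using int by (subst Bochner_Integration.integral_sum) auto
      also have "\<dots> = r\<^sup>2 * (\<Sum>l\<in>I. c l * E (F l) r z)"
        unfolding poly_square_mean E_def using that by (simp add: sum_distrib_left)
      finally show ?thesis .
    qed
    have Elim: "(\<lambda>n. E p (h n) z) \<longlonglongrightarrow> 2 * pi * (norm (poly (pderiv p) z))\<^sup>2" if "norm z \<le> 1" for p z
      unfolding E_def by (rule poly_square_mean_limit[OF h_lim h_pos h1(1) that])
    have "\<forall>p. \<exists>D. \<forall>z n. norm z \<le> 1 \<longrightarrow> \<bar>E p (h n) z\<bar> \<le> D"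
    proof
      fix p
      obtain D where "\<forall>z r. norm z \<le> 1 \<longrightarrow> 0 < r \<longrightarrow> r \<le> 1 \<longrightarrow> \<bar>E p r z\<bar> \<le> D"
        unfolding E_def using poly_square_mean_bounded[of p] by blast
      then have "\<forall>z n. norm z \<le> 1 \<longrightarrow> \<bar>E p (h n) z\<bar> \<le> D" using h_pos h1(1) by blast
      then show "\<exists>D. \<forall>z n. norm z \<le> 1 \<longrightarrow> \<bar>E p (h n) z\<bar> \<le> D" ..
    qed
    from choice[OF this] obtain D
      where D: "\<And>p z n. norm z \<le> 1 \<Longrightarrow> \<bar>E p (h n) z\<bar> \<le> D p" by blast
    have Em [measurable]: "(\<lambda>z. E p r z) \<in> borel_measurable borel" for p r
      unfolding E_def
      by (intro borel_measurable_divide borel_measurable_const angle_measure.borel_measurable_lebesgue_integral) measurable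
    have "(\<lambda>n. \<integral>z. indicator K z * u z * (\<Sum>l\<in>I. c l * E (F l) (h n) z) \<partial>disc_measure)
        \<longlonglongrightarrow> (\<integral>z. indicator K z * u z * (2 * pi * \<Lambda> z) \<partial>disc_measure)"
    proof (rule integral_dominated_convergence[where w = "\<lambda>_. \<bar>M\<bar> * (\<Sum>l\<in>I. \<bar>c l\<bar> * D (F l))"])
      show "AE z in disc_measure. (\<lambda>n. indicator K z * u z * (\<Sum>l\<in>I. c l * E (F l) (h n) z))
              \<longlonglongrightarrow> indicator K z * u z * (2 * pi * \<Lambda> z)"
      proof (rule AE_mp[OF AE_disc], rule AE_I2, rule impI)
        fix z :: complex assume "z \<in> ball 0 1"
        then have "(\<lambda>n. indicator K z * u z * (\<Sum>l\<in>I. c l * E (F l) (h n) z))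
            \<longlonglongrightarrow> indicator K z * u z * (\<Sum>l\<in>I. c l * (2 * pi * (norm (poly (pderiv (F l)) z))\<^sup>2))"
          by (intro tendsto_intros Elim) simp
        then show "(\<lambda>n. indicator K z * u z * (\<Sum>l\<in>I. c l * E (F l) (h n) z))
            \<longlonglongrightarrow> indicator K z * u z * (2 * pi * \<Lambda> z)"
          by (simp add: \<Lambda>_def sum_distrib_left mult_ac)
      qed
      show "AE z in disc_measure. norm (indicator K z * u z * (\<Sum>l\<in>I. c l * E (F l) (h n) z))
              \<le> \<bar>M\<bar> * (\<Sum>l\<in>I. \<bar>c l\<bar> * D (F l))" for n
      proof (rule AE_mp[OF AE_disc], rule AE_I2, rule impI)
        fix z :: complex assume z: "z \<in> ball 0 1"
        have "\<bar>\<Sum>l\<in>I. c l * E (F l) (h n) z\<bar> \<le> (\<Sum>l\<in>I. \<bar>c l * E (F l) (h n) z\<bar>)" by (rule sum_abs)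
        also have "\<dots> \<le> (\<Sum>l\<in>I. \<bar>c l\<bar> * D (F l))"
          unfolding abs_mult using z by (intro sum_mono mult_left_mono D) auto
        finally have "\<bar>indicator K z * u z\<bar> * \<bar>\<Sum>l\<in>I. c l * E (F l) (h n) z\<bar> \<le> \<bar>M\<bar> * (\<Sum>l\<in>I. \<bar>c l\<bar> * D (F l))"
          using u0[of z] uM[of z] by (intro mult_mono) (auto simp: indicator_def)
        then show "norm (indicator K z * u z * (\<Sum>l\<in>I. c l * E (F l) (h n) z)) \<le> \<bar>M\<bar> * (\<Sum>l\<in>I. \<bar>c l\<bar> * D (F l))"
          by (simp add: abs_mult)
      qed
    qed measurable
    moreover have "(\<integral>z. indicator K z * u z * (\<Sum>l\<in>I. c l * E (F l) (h n) z) \<partial>disc_measure) \<le> 0" for n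
    proof -
      have "(h n)\<^sup>2 * (\<integral>z. indicator K z * u z * (\<Sum>l\<in>I. c l * E (F l) (h n) z) \<partial>disc_measure)
         = (\<integral>z. indicator K z * u z * (\<integral>t. \<phi> (z - of_real (h n) * cis t) - \<phi> z \<partial>angle_measure) \<partial>disc_measure)"
        unfolding E[OF h_pos] integral_mult_right_zero[symmetric] by (simp add: mult_ac)
      also have "\<dots> \<le> 0" by (rule neg[OF h_pos h1(2)])
      finally show ?thesis using h_pos[of n] by (simp add: mult_le_0_iff)
    qed
    ultimately have "(\<integral>z. indicator K z * u z * (2 * pi * \<Lambda> z) \<partial>disc_measure) \<le> 0"
      by (elim LIMSEQ_le_const2) auto
    then show ?thesis unfolding K_def .
  qed
  have "(\<lambda>n. \<integral>z. indicator {z \<in> ball 0 1. inverse (real (Suc n)) \<le> \<phi> z} z * u z * (2 * pi * \<Lambda> z) \<partial>disc_measure)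
        \<longlonglongrightarrow> (\<integral>z. indicator {z. 0 < \<phi> z} z * u z * (2 * pi * \<Lambda> z) \<partial>disc_measure)"
  proof (rule integral_dominated_convergence[where w = "\<lambda>_. \<bar>M\<bar> * (2 * pi * B)"])
    show "AE z in disc_measure. (\<lambda>n. indicator {z \<in> ball 0 1. inverse (real (Suc n)) \<le> \<phi> z} z * u z * (2 * pi * \<Lambda> z))
            \<longlonglongrightarrow> indicator {z. 0 < \<phi> z} z * u z * (2 * pi * \<Lambda> z)"
    proof (rule AE_mp[OF AE_disc], rule AE_I2, rule impI)
      fix z :: complex assume z: "z \<in> ball 0 1"
      have "\<forall>\<^sub>F n in sequentially. indicator {z \<in> ball 0 1. inverse (real (Suc n)) \<le> \<phi> z} z
               = (indicator {z. 0 < \<phi> z} z :: real)"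
      proof (cases "0 < \<phi> z")
        case True
        have "\<forall>\<^sub>F n in sequentially. inverse (real (Suc n)) < \<phi> z"
          using LIMSEQ_inverse_real_of_nat True by (rule order_tendstoD)
        then show ?thesis by eventually_elim (use z True in auto)
      next
        case False
        then have "\<not> inverse (real (Suc n)) \<le> \<phi> z" for n
          using inverse_positive_iff_positive[of "real (Suc n)"] by linarith
        then show ?thesis using False by (intro always_eventually allI) auto
      qed
      then have "(\<lambda>n. indicator {z \<in> ball 0 1. inverse (real (Suc n)) \<le> \<phi> z} z :: real) \<longlonglongrightarrow> indicator {z. 0 < \<phi> z} z"
        by (rule tendsto_eventually)
      then show "(\<lambda>n. indicator {z \<in> ball 0 1. inverse (real (Suc n)) \<le> \<phi> z} z * u z * (2 * pi * \<Lambda> z))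
            \<longlonglongrightarrow> indicator {z. 0 < \<phi> z} z * u z * (2 * pi * \<Lambda> z)"
        by (intro tendsto_intros)
    qed
    show "AE z in disc_measure. norm (indicator {z \<in> ball 0 1. inverse (real (Suc n)) \<le> \<phi> z} z * u z * (2 * pi * \<Lambda> z))
              \<le> \<bar>M\<bar> * (2 * pi * B)" for n
    proof (rule AE_mp[OF AE_disc], rule AE_I2, rule impI)
      fix z :: complex assume z: "z \<in> ball 0 1"
      have "\<bar>indicator {z \<in> ball 0 1. inverse (real (Suc n)) \<le> \<phi> z} z * u z\<bar> * \<bar>2 * pi * \<Lambda> z\<bar> \<le> \<bar>M\<bar> * (2 * pi * B)"
        using u0[of z] uM[of z] B[of z] z by (intro mult_mono) (auto simp: indicator_def abs_mult)
      then show "norm (indicator {z \<in> ball 0 1. inverse (real (Suc n)) \<le> \<phi> z} z * u z * (2 * pi * \<Lambda> z)) \<le> \<bar>M\<bar> * (2 * pi * B)"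
        by (simp add: abs_mult)
    qed
    have "{z. 0 < \<phi> z} \<in> sets borel"
      by (simp add: borel_open open_Collect_less \<phi>c)
    then show "(\<lambda>z. indicator {z. 0 < \<phi> z} z * u z * (2 * pi * \<Lambda> z)) \<in> borel_measurable disc_measure" by simp
    show "(\<lambda>z. indicator {z \<in> ball 0 1. inverse (real (Suc n)) \<le> \<phi> z} z * u z * (2 * pi * \<Lambda> z)) \<in> borel_measurable disc_measure" for n
      using Km[of "inverse (real (Suc n))"] by simp
  qed simp
  then have "(\<integral>z. indicator {z. 0 < \<phi> z} z * u z * (2 * pi * \<Lambda> z) \<partial>disc_measure) \<le> 0"
    by (rule LIMSEQ_le_const2) (intro exI[of _ 0] allI impI truncated, simp)
  also have "(\<integral>z. indicator {z. 0 < \<phi> z} z * u z * (2 * pi * \<Lambda> z) \<partial>disc_measure)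
      = 2 * pi * (\<integral>z. indicator {z. 0 < \<phi> z} z * (u z * \<Lambda> z) \<partial>disc_measure)"
    unfolding integral_mult_right_zero[symmetric] by (simp add: mult_ac)
  finally have "(\<integral>z. indicator {z. 0 < \<phi> z} z * (u z * \<Lambda> z) \<partial>disc_measure) \<le> 0"
    using pi_gt_zero by (auto simp: mult_le_0_iff)
  then show ?thesis unfolding \<phi>_def \<Lambda>_def .
qed

section \<open>The Dirichlet form of a bounded superharmonic weight\<close>

definition energy_form :: "(complex \<Rightarrow> real) \<Rightarrow> complex poly \<Rightarrow> complex poly \<Rightarrow> real" where
  "energy_form u p q = (\<integral>z. u z * Re (poly (pderiv p) z * cnj (poly (pderiv q) z)) \<partial>disc_measure)"

lemma energy_form_self: "energy_form u p p = (\<integral>z. u z * (norm (poly (pderiv p) z))\<^sup>2 \<partial>disc_measure)"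
  unfolding energy_form_def by (simp add: complex_norm_square[symmetric])

lemma weighted_integrable:
  fixes g :: "complex \<Rightarrow> real"
  assumes "u \<in> borel_measurable borel" "\<And>z. 0 \<le> u z \<and> u z \<le> M" "continuous_on UNIV g"
  shows "integrable disc_measure (\<lambda>z. u z * g z)"
proof -
  obtain B where B: "\<And>z. z \<in> cball 0 1 \<Longrightarrow> norm (g z) \<le> B"
    using continuous_on_cball_bounded[OF continuous_on_subset[OF assms(3) subset_UNIV], of 0 1] by blast
  show ?thesis
  proof (rule disc_integrable[where B = "M * B"])
    show "(\<lambda>z. u z * g z) \<in> borel_measurable borel"
      using assms(1) borel_measurable_continuous_onI[OF assms(3)] by simp
    fix z :: complex assume "norm z < 1"
    then have "\<bar>u z\<bar> * \<bar>g z\<bar> \<le> M * B"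
      using assms(2)[of z] B[of z] by (intro mult_mono) auto
    then show "norm (u z * g z) \<le> M * B" by (simp add: abs_mult)
  qed
qed

lemma AE_disc_finite:
  assumes "finite A"
  shows "AE z in disc_measure. z \<notin> A"
proof -
  have "AE z in lborel. z \<notin> A"
    using finite_imp_null_set_lborel[OF assms] by (rule AE_not_in)
  then show ?thesis
    unfolding disc_measure_def by (subst AE_density) (auto intro: AE_mp)
qed

lemma bounded_superharmonicD:
  assumes "bounded_superharmonic u"
  obtains M where "u \<in> borel_measurable borel" "\<And>z. 0 \<le> u z \<and> u z \<le> M"
  using assms unfolding bounded_superharmonic_def by blast

lemma energy_form_combination_nonpos:
  fixes c :: "'i \<Rightarrow> real" and F :: "'i \<Rightarrow> complex poly"
  assumes u: "bounded_superharmonic u" and I: "finite I"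
    and \<phi>0: "\<And>z. norm z = 1 \<Longrightarrow> (\<Sum>l\<in>I. c l * (norm (poly (F l) z))\<^sup>2) = 0"
    and A: "finite A"
    and pos: "\<And>z. norm z < 1 \<Longrightarrow> z \<notin> A \<Longrightarrow> 0 < (\<Sum>l\<in>I. c l * (norm (poly (F l) z))\<^sup>2)"
  shows "(\<Sum>l\<in>I. c l * energy_form u (F l) (F l)) \<le> 0"
proof -
  obtain M where um: "u \<in> borel_measurable borel" and uM: "\<And>z. 0 \<le> u z \<and> u z \<le> M"
    using bounded_superharmonicD[OF u] by blast
  define \<phi> where "\<phi> z = (\<Sum>l\<in>I. c l * (norm (poly (F l) z))\<^sup>2)" for z
  define \<Lambda> where "\<Lambda> z = (\<Sum>l\<in>I. c l * (norm (poly (pderiv (F l)) z))\<^sup>2)" for z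
  have int: "integrable disc_measure (\<lambda>z. u z * (norm (poly (pderiv p) z))\<^sup>2)" for p
    by (rule weighted_integrable[OF um uM]) (intro continuous_intros)
  have "(\<Sum>l\<in>I. c l * energy_form u (F l) (F l)) = (\<integral>z. (\<Sum>l\<in>I. c l * (u z * (norm (poly (pderiv (F l)) z))\<^sup>2)) \<partial>disc_measure)"
    unfolding energy_form_self using int by (subst Bochner_Integration.integral_sum) auto
  also have "\<dots> = (\<integral>z. u z * \<Lambda> z \<partial>disc_measure)"
    unfolding \<Lambda>_def by (simp add: sum_distrib_left mult_ac)
  also have "\<dots> = (\<integral>z. indicator {z. 0 < \<phi> z} z * (u z * \<Lambda> z) \<partial>disc_measure)"
  proof (rule integral_cong_AE)
    have \<phi>c: "continuous_on UNIV \<phi>" and \<Lambda>c: "continuous_on UNIV \<Lambda>"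
      unfolding \<phi>_def \<Lambda>_def by (intro continuous_intros)+
    have "\<Lambda> \<in> borel_measurable borel" using \<Lambda>c by (rule borel_measurable_continuous_onI)
    moreover have "{z. 0 < \<phi> z} \<in> sets borel" by (simp add: borel_open open_Collect_less \<phi>c)
    ultimately show "(\<lambda>z. u z * \<Lambda> z) \<in> borel_measurable disc_measure"
      "(\<lambda>z. indicator {z. 0 < \<phi> z} z * (u z * \<Lambda> z)) \<in> borel_measurable disc_measure"
      using um by simp_all
    show "AE z in disc_measure. u z * \<Lambda> z = indicator {z. 0 < \<phi> z} z * (u z * \<Lambda> z)"
      using AE_disc AE_disc_finite[OF A] by eventually_elim (use pos in \<open>auto simp: \<phi>_def\<close>)
  qed
  also have "\<dots> \<le> 0"
    unfolding \<phi>_def \<Lambda>_def by (rule superharmonic_test_inequality[OF u I \<phi>0])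
  finally show ?thesis .
qed

text \<open>
  Expansiveness tests \<open>u\<close> against \<open>(1 - |z|\<^sup>2) |p|\<^sup>2 = |p|\<^sup>2 - |z p|\<^sup>2\<close>, and concavity tests it against
  \<open>(1 - |z|\<^sup>2)\<^sup>2 |p|\<^sup>2 = |p|\<^sup>2 - 2 |z p|\<^sup>2 + |z\<^sup>2 p|\<^sup>2\<close>. Both are positive off the finitely many zeros of \<open>p\<close>.
\<close>

theorem energy_form_concave_shift_form:
  assumes u: "bounded_superharmonic u"
  shows "concave_shift_form (energy_form u)"
proof
  obtain M where um: "u \<in> borel_measurable borel" and uM: "\<And>z. 0 \<le> u z \<and> u z \<le> M"
    using bounded_superharmonicD[OF u] by blast
  have int: "integrable disc_measure (\<lambda>z. u z * Re (poly (pderiv p) z * cnj (poly (pderiv q) z)))" for p q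
    by (rule weighted_integrable[OF um uM]) (intro continuous_intros)
  fix p q r :: "complex poly" and c :: real and a :: complex
  show "energy_form u p q = energy_form u q p"
    unfolding energy_form_def by (simp add: mult_ac)
  show "energy_form u (p + q) r = energy_form u p r + energy_form u q r"
    unfolding energy_form_def using int[of p r] int[of q r]
    by (subst Bochner_Integration.integral_add[symmetric]) (auto simp: pderiv_add algebra_simps)
  show "energy_form u (smult (of_real c) p) q = c * energy_form u p q"
    unfolding energy_form_def integral_mult_right_zero[symmetric]
    by (rule Bochner_Integration.integral_cong) (auto simp: pderiv_smult algebra_simps)
  show "energy_form u [:a:] q = 0"
    unfolding energy_form_def by (simp add: pderiv_pCons)
  have zero: "energy_form u 0 0 = 0" by (simp add: energy_form_def)
  define F where "F l = (pCons 0 ^^ l) p" for l :: nat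
  have F: "(norm (poly (F l) z))\<^sup>2 = ((norm z)\<^sup>2) ^ l * (norm (poly p z))\<^sup>2" for l z
    unfolding F_def by (induction l) (simp_all add: norm_mult power_mult_distrib)
  show "energy_form u p p \<le> energy_form u (pCons 0 p) (pCons 0 p)"
  proof (cases "p = 0")
    case False
    define c where "c l = (if l = 0 then 1 else - 1 :: real)" for l :: nat
    have \<phi>: "(\<Sum>l\<in>{0,1}. c l * (norm (poly (F l) z))\<^sup>2) = (1 - (norm z)\<^sup>2) * (norm (poly p z))\<^sup>2" for z
      unfolding F c_def by (simp add: algebra_simps)
    have \<phi>0: "(\<Sum>l\<in>{0,1}. c l * (norm (poly (F l) z))\<^sup>2) = 0" if "norm z = 1" for z
      unfolding \<phi> using that by simp
    have "(\<Sum>l\<in>{0,1}. c l * energy_form u (F l) (F l)) \<le> 0"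
    proof (rule energy_form_combination_nonpos[OF u _ \<phi>0 poly_roots_finite[OF False]])
      fix z :: complex assume z: "norm z < 1" "z \<notin> {z. poly p z = 0}"
      then have "(norm z)\<^sup>2 < 1" by (simp add: power_less_one_iff)
      then show "0 < (\<Sum>l\<in>{0,1}. c l * (norm (poly (F l) z))\<^sup>2)"
        unfolding \<phi> using z by simp
    qed simp
    then show ?thesis by (simp add: c_def F_def)
  qed (simp add: zero)
  show "energy_form u (pCons 0 (pCons 0 p)) (pCons 0 (pCons 0 p)) + energy_form u p p
          \<le> 2 * energy_form u (pCons 0 p) (pCons 0 p)"
  proof (cases "p = 0")
    case False
    define c where "c l = (if l = 1 then - 2 else 1 :: real)" for l :: nat
    have \<phi>: "(\<Sum>l\<in>{0,1,2}. c l * (norm (poly (F l) z))\<^sup>2) = (1 - (norm z)\<^sup>2)\<^sup>2 * (norm (poly p z))\<^sup>2" for z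
      unfolding F c_def by (simp add: algebra_simps power2_eq_square)
    have \<phi>0: "(\<Sum>l\<in>{0,1,2}. c l * (norm (poly (F l) z))\<^sup>2) = 0" if "norm z = 1" for z
      unfolding \<phi> using that by simp
    have "(\<Sum>l\<in>{0,1,2}. c l * energy_form u (F l) (F l)) \<le> 0"
    proof (rule energy_form_combination_nonpos[OF u _ \<phi>0 poly_roots_finite[OF False]])
      fix z :: complex assume z: "norm z < 1" "z \<notin> {z. poly p z = 0}"
      then have "(norm z)\<^sup>2 < 1" by (simp add: power_less_one_iff)
      then show "0 < (\<Sum>l\<in>{0,1,2}. c l * (norm (poly (F l) z))\<^sup>2)"
        unfolding \<phi> using z by simp
    qed simp
    then show ?thesis by (simp add: c_def F_def numeral_2_eq_2)
  qed (simp add: zero)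
qed

section \<open>Cesaro coefficients\<close>

definition cesaro_coeff :: "real \<Rightarrow> nat \<Rightarrow> nat \<Rightarrow> real" where
  "cesaro_coeff \<alpha> n k = (if k \<le> n then cesaro_binomial \<alpha> (n - k) / cesaro_binomial \<alpha> n else 0)"

lemma cesaro_binomial_0: "\<alpha> > 0 \<Longrightarrow> cesaro_binomial \<alpha> 0 = 1"
  using less_imp_neq[OF Gamma_real_pos[of "\<alpha> + 1"]] by (simp add: cesaro_binomial_def)

lemma cesaro_binomial_pos: "\<alpha> > 0 \<Longrightarrow> cesaro_binomial \<alpha> n > 0"
  unfolding cesaro_binomial_def by (intro divide_pos_pos mult_pos_pos Gamma_real_pos) auto

lemma cesaro_binomial_Suc:
  assumes "\<alpha> > 0"
  shows "(real n + 1) * cesaro_binomial \<alpha> (Suc n) = (real n + 1 + \<alpha>) * cesaro_binomial \<alpha> n"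
proof -
  have "Gamma (real n + \<alpha> + 1 + 1) = (real n + \<alpha> + 1) * Gamma (real n + \<alpha> + 1)"
    using assms by (intro Gamma_plus1) (auto elim!: nonpos_Ints_cases)
  moreover have "Gamma (real n + 1 + 1) = (real n + 1) * Gamma (real n + 1)"
    by (intro Gamma_plus1) (auto elim!: nonpos_Ints_cases)
  moreover have "Gamma (real n + 1) > 0" "Gamma (\<alpha> + 1) > 0"
    using assms by (auto intro!: Gamma_real_pos)
  ultimately show ?thesis
    unfolding cesaro_binomial_def by (simp add: divide_simps)
qed

lemma cesaro_binomial_mono:
  assumes "\<alpha> > 0" "m \<le> n"
  shows "cesaro_binomial \<alpha> m \<le> cesaro_binomial \<alpha> n"
proof -
  have "cesaro_binomial \<alpha> k \<le> cesaro_binomial \<alpha> (Suc k)" for k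
  proof -
    have "(real k + 1) * cesaro_binomial \<alpha> k \<le> (real k + 1) * cesaro_binomial \<alpha> (Suc k)"
      unfolding cesaro_binomial_Suc[OF assms(1)] using cesaro_binomial_pos[OF assms(1), of k] assms(1)
      by (intro mult_right_mono) auto
    then show ?thesis by simp
  qed
  then show ?thesis using assms(2) by (rule lift_Suc_mono_le)
qed

lemma cesaro_coeff_le_1:
  assumes "\<alpha> > 0"
  shows "\<bar>cesaro_coeff \<alpha> n k\<bar> \<le> 1"
  using cesaro_binomial_pos[OF assms] cesaro_binomial_mono[OF assms, of "n - k" n]
  by (auto simp: cesaro_coeff_def abs_of_pos field_simps)

lemma cesaro_coeff_0: "\<alpha> > 0 \<Longrightarrow> cesaro_coeff \<alpha> n 0 = 1"
  using cesaro_binomial_pos[of \<alpha> n] by (simp add: cesaro_coeff_def)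

text \<open>
  By induction on \<open>n\<close>, using the recursion \<open>(n + 1) b\<^sub>n\<^sub>+\<^sub>1 = (n + 1 + \<alpha>) b\<^sub>n\<close> of the binomials. With \<open>N = n + 1\<close>
  the induction step reduces to \<open>(N + 1) (C N + \<alpha>\<^sup>2) \<le> C (N + \<alpha>)\<^sup>2\<close>, that is,
  \<open>\<alpha>\<^sup>2 (N + 1) \<le> C ((2 \<alpha> - 1) N + \<alpha>\<^sup>2)\<close>. This dictates the constant and is where \<open>\<alpha> > 1 / 2\<close> enters.
  The summand 1 is the square of \<open>b\<^sub>0\<close>, which accounts for the drop of the coefficients to 0 after index \<open>n\<close>.
\<close>

lemma sum_cesaro_binomial_increments_le:
  assumes \<alpha>: "\<alpha> > 1 / 2"
  defines "C \<equiv> max 1 (\<alpha>\<^sup>2 / (2 * \<alpha> - 1))"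
  shows "real (Suc n) * (1 + (\<Sum>m<n. (cesaro_binomial \<alpha> (Suc m) - cesaro_binomial \<alpha> m)\<^sup>2))
           \<le> C * (cesaro_binomial \<alpha> n)\<^sup>2"
proof (induction n)
  case 0
  then show ?case using \<alpha> by (simp add: cesaro_binomial_0 C_def)
next
  case (Suc n)
  define b where "b = cesaro_binomial \<alpha> (Suc n)"
  define N where "N = real n + 1"
  define S where "S = 1 + (\<Sum>m<n. (cesaro_binomial \<alpha> (Suc m) - cesaro_binomial \<alpha> m)\<^sup>2)"
  have N: "N \<ge> 1" and N\<alpha>: "N + \<alpha> > 0" using \<alpha> by (auto simp: N_def)
  have prev: "cesaro_binomial \<alpha> n = N * b / (N + \<alpha>)"
    using cesaro_binomial_Suc[of \<alpha> n] \<alpha> N\<alpha> by (simp add: b_def N_def field_simps)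
  have IH: "N * S \<le> C * (N * b / (N + \<alpha>))\<^sup>2"
    using Suc.IH unfolding prev S_def[symmetric] by (simp add: N_def add.commute)
  have "N * S \<le> N * (C * N * b\<^sup>2 / (N + \<alpha>)\<^sup>2)"
    using IH by (simp add: power_divide power_mult_distrib power2_eq_square mult_ac)
  then have S: "S \<le> C * N * b\<^sup>2 / (N + \<alpha>)\<^sup>2"
    using N by (subst (asm) mult_le_cancel_left_pos) auto
  have inc: "b - N * b / (N + \<alpha>) = \<alpha> * b / (N + \<alpha>)"
    using N\<alpha> by (simp add: field_simps)
  have C1: "C \<ge> 1" and C2: "\<alpha>\<^sup>2 \<le> C * (2 * \<alpha> - 1)"
    using \<alpha> by (auto simp: C_def field_simps max_def)
  have "(N + 1) * (C * N + \<alpha>\<^sup>2) \<le> C * (N + \<alpha>)\<^sup>2"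
  proof -
    have "\<alpha>\<^sup>2 * N \<le> C * (2 * \<alpha> - 1) * N" using C2 N by (intro mult_right_mono) auto
    moreover have "\<alpha>\<^sup>2 \<le> C * \<alpha>\<^sup>2" using C1 by (simp add: mult_le_cancel_right1)
    ultimately show ?thesis by (simp add: power2_eq_square algebra_simps)
  qed
  then have key: "(N + 1) * (C * N + \<alpha>\<^sup>2) / (N + \<alpha>)\<^sup>2 \<le> C"
    using N\<alpha> by (simp add: pos_divide_le_eq)
  have "(N + 1) * (S + (b - N * b / (N + \<alpha>))\<^sup>2)
          \<le> (N + 1) * (C * N * b\<^sup>2 / (N + \<alpha>)\<^sup>2 + (\<alpha> * b / (N + \<alpha>))\<^sup>2)"
    unfolding inc using S N by (intro mult_left_mono add_mono) auto
  also have "\<dots> = ((N + 1) * (C * N + \<alpha>\<^sup>2) / (N + \<alpha>)\<^sup>2) * b\<^sup>2"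
    by (simp add: power_divide power_mult_distrib add_divide_distrib distrib_left distrib_right mult_ac)
  also have "\<dots> \<le> C * b\<^sup>2"
    using key by (intro mult_right_mono) auto
  finally show ?case
    unfolding S_def prev[symmetric] by (simp add: N_def b_def add_ac)
qed

lemma cesaro_coeff_variation:
  assumes \<alpha>: "\<alpha> > 1 / 2"
  shows "real n * (\<Sum>j\<le>n. (cesaro_coeff \<alpha> n (Suc j) - cesaro_coeff \<alpha> n j)\<^sup>2)
           \<le> max 1 (\<alpha>\<^sup>2 / (2 * \<alpha> - 1))"
proof -
  define b where "b = cesaro_binomial \<alpha>"
  have b: "b n > 0" "b 0 = 1" using \<alpha> by (simp_all add: b_def cesaro_binomial_pos cesaro_binomial_0)
  have "(\<Sum>j\<le>n. (cesaro_coeff \<alpha> n (Suc j) - cesaro_coeff \<alpha> n j)\<^sup>2)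
      = (\<Sum>j<n. (cesaro_coeff \<alpha> n (Suc j) - cesaro_coeff \<alpha> n j)\<^sup>2) + 1 / (b n)\<^sup>2"
    using b by (simp add: lessThan_Suc_atMost[symmetric] cesaro_coeff_def power_divide flip: b_def)
  also have "(\<Sum>j<n. (cesaro_coeff \<alpha> n (Suc j) - cesaro_coeff \<alpha> n j)\<^sup>2)
      = (\<Sum>j<n. (b (n - j) - b (n - Suc j))\<^sup>2 / (b n)\<^sup>2)"
    by (rule sum.cong) (auto simp: cesaro_coeff_def power_divide power2_commute simp flip: b_def diff_divide_distrib)
  also have "\<dots> = (\<Sum>j<n. (b (Suc (n - Suc j)) - b (n - Suc j))\<^sup>2 / (b n)\<^sup>2)"
    by (rule sum.cong) (auto simp: Suc_diff_Suc)
  also have "\<dots> = (\<Sum>m<n. (b (Suc m) - b m)\<^sup>2 / (b n)\<^sup>2)"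
    by (rule sum.nat_diff_reindex)
  finally have eq: "(\<Sum>j\<le>n. (cesaro_coeff \<alpha> n (Suc j) - cesaro_coeff \<alpha> n j)\<^sup>2)
      = (1 + (\<Sum>m<n. (b (Suc m) - b m)\<^sup>2)) / (b n)\<^sup>2"
    by (simp add: add_divide_distrib sum_divide_distrib)
  have "real n * (1 + (\<Sum>m<n. (b (Suc m) - b m)\<^sup>2)) \<le> real (Suc n) * (1 + (\<Sum>m<n. (b (Suc m) - b m)\<^sup>2))"
    by (intro mult_right_mono add_nonneg_nonneg sum_nonneg) auto
  also have "\<dots> \<le> max 1 (\<alpha>\<^sup>2 / (2 * \<alpha> - 1)) * (b n)\<^sup>2"
    unfolding b_def by (rule sum_cesaro_binomial_increments_le[OF \<alpha>])
  finally show ?thesis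
    unfolding eq using b by (simp add: field_simps)
qed

lemma cesaro_coeff_tendsto_1:
  assumes \<alpha>: "\<alpha> > 0"
  shows "(\<lambda>n. cesaro_coeff \<alpha> n k) \<longlonglongrightarrow> 1"
proof (induction k)
  case 0
  then show ?case using \<alpha> by (simp add: cesaro_coeff_0)
next
  case (Suc k)
  have "(\<lambda>n. real (n - k) / (real (n - k) + \<alpha>)) \<longlonglongrightarrow> 1"
    using \<alpha> by real_asymp
  from tendsto_mult[OF Suc.IH this]
  have "(\<lambda>n. cesaro_coeff \<alpha> n k * (real (n - k) / (real (n - k) + \<alpha>))) \<longlonglongrightarrow> 1" by simp
  moreover have "\<forall>\<^sub>F n in sequentially. cesaro_coeff \<alpha> n k * (real (n - k) / (real (n - k) + \<alpha>))
      = cesaro_coeff \<alpha> n (Suc k)"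
    using eventually_gt_at_top[of k]
  proof eventually_elim
    case (elim n)
    define m where "m = n - Suc k"
    have nk: "n - k = Suc m" using elim by (simp add: m_def)
    have "cesaro_binomial \<alpha> (Suc m) * real (Suc m) / (real (Suc m) + \<alpha>) = cesaro_binomial \<alpha> m"
      using cesaro_binomial_Suc[OF \<alpha>, of m] \<alpha> by (simp add: field_simps)
    then have "cesaro_binomial \<alpha> (n - k) * (real (n - k) / (real (n - k) + \<alpha>)) = cesaro_binomial \<alpha> (n - Suc k)"
      unfolding nk m_def by simp
    then have "cesaro_binomial \<alpha> (n - k) / cesaro_binomial \<alpha> n * (real (n - k) / (real (n - k) + \<alpha>))
        = cesaro_binomial \<alpha> (n - Suc k) / cesaro_binomial \<alpha> n"
      by (metis times_divide_eq_left)
    then show ?case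
      unfolding cesaro_coeff_def using elim by (simp only: if_True less_imp_le Suc_leI)
  qed
  ultimately show ?case by (rule Lim_transform_eventually)
qed

section \<open>Power series on the disc\<close>

definition disc_series :: "(nat \<Rightarrow> complex) \<Rightarrow> (complex \<Rightarrow> complex) \<Rightarrow> bool" where
  "disc_series a f \<longleftrightarrow> (\<forall>z\<in>ball 0 1. (\<lambda>k. a k * z ^ k) sums f z)"

lemma disc_series_holomorphic:
  assumes "f holomorphic_on ball 0 1"
  shows "disc_series (fps_nth (fps_expansion f 0)) f"
  unfolding disc_series_def fps_expansion_def
  using holomorphic_power_series[OF assms] by simp

lemma disc_series_has_derivative:
  assumes "disc_series a f" "norm z < 1"
  shows "(f has_field_derivative (\<Sum>k. diffs a k * z ^ k)) (at z)"
proof -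
  have "((\<lambda>z. \<Sum>k. a k * z ^ k) has_field_derivative (\<Sum>k. diffs a k * z ^ k)) (at z)"
    using assms by (intro termdiffs_strong'[where K = 1]) (auto simp: disc_series_def sums_iff)
  then show ?thesis
  proof (rule has_field_derivative_transform_within_open)
    show "open (ball (0::complex) 1)" "z \<in> ball 0 1" using assms by auto
    show "(\<Sum>k. a k * x ^ k) = f x" if "x \<in> ball 0 1" for x
      using assms(1) that by (auto simp: disc_series_def sums_iff)
  qed
qed

lemma disc_series_abs_summable:
  assumes "disc_series a f" "norm z < 1"
  shows "summable (\<lambda>k. norm (diffs a k * z ^ k))"
proof -
  define r where "r = (norm z + 1) / 2"
  have r: "norm z < r" "r < 1" "0 \<le> r" using assms(2) by (auto simp: r_def)
  have "summable (\<lambda>k. diffs a k * of_real r ^ k)"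
    using assms(1) r by (intro termdiff_converges[where K = 1]) (auto simp: disc_series_def sums_iff)
  then show ?thesis by (rule powser_insidea) (use r in simp)
qed

lemma disc_series_deriv:
  assumes "disc_series a f" "norm z < 1"
  shows "(\<lambda>k. diffs a k * z ^ k) sums deriv f z"
  using disc_series_abs_summable[OF assms] DERIV_imp_deriv[OF disc_series_has_derivative[OF assms]]
  by (simp add: sums_iff summable_norm_cancel)

lemma disc_series_imp_holomorphic: "disc_series a f \<Longrightarrow> f holomorphic_on ball 0 1"
  using disc_series_has_derivative
  by (metis field_differentiable_at_within field_differentiable_def holomorphic_on_def mem_ball_0)

lemma disc_series_diff:
  assumes "disc_series a f" "disc_series b g"
  shows "disc_series (\<lambda>k. a k - b k) (\<lambda>z. f z - g z)"
  using assms by (auto simp: disc_series_def left_diff_distrib intro: sums_diff)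

lemma disc_series_dilate:
  assumes "disc_series a f" "0 \<le> r" "r \<le> 1"
  shows "disc_series (\<lambda>k. of_real (r ^ k) * a k) (\<lambda>z. f (of_real r * z))"
  unfolding disc_series_def
proof
  fix z :: complex assume "z \<in> ball 0 1"
  then have "r * norm z < 1" using assms mult_left_le_one_le[of "norm z" r] by force
  then have "of_real r * z \<in> ball 0 1" using assms by (simp add: norm_mult)
  then have "(\<lambda>k. a k * (of_real r * z) ^ k) sums f (of_real r * z)"
    using assms by (simp add: disc_series_def)
  then show "(\<lambda>k. of_real (r ^ k) * a k * z ^ k) sums f (of_real r * z)"
    by (simp add: power_mult_distrib mult_ac)
qed

text \<open>
  The derivative is cut off outside the disc to obtain a function that is Borel measurable on the
  plane.
\<close>

definition disc_deriv :: "(complex \<Rightarrow> complex) \<Rightarrow> complex \<Rightarrow> complex" where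
  "disc_deriv f z = indicator (ball 0 1) z *\<^sub>R deriv f z"

lemma disc_deriv_measurable:
  assumes "disc_series a f"
  shows "disc_deriv f \<in> borel_measurable borel"
  unfolding disc_deriv_def
  by (intro borel_measurable_continuous_on_indicator holomorphic_on_imp_continuous_on
      holomorphic_deriv disc_series_imp_holomorphic[OF assms]) auto

text \<open>
  The partial sums of the Taylor series of \<open>f(R z)\<close>; the degree \<open>n + 1\<close> makes the derivative a sum
  over \<open>k \<le> n\<close>.
\<close>

definition taylor_poly :: "(nat \<Rightarrow> complex) \<Rightarrow> real \<Rightarrow> nat \<Rightarrow> complex poly" where
  "taylor_poly a R n = (\<Sum>k\<le>Suc n. monom (a k * of_real R ^ k) k)"

lemma hadamard_taylor_poly: "hadamard c (taylor_poly a R n) = taylor_poly (\<lambda>k. of_real (c k) * a k) R n"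
  by (rule poly_eqI) (simp only: coeff_hadamard taylor_poly_def coeff_sum coeff_monom, auto simp: sum.delta)

lemma pderiv_sum: "pderiv (\<Sum>k\<in>A. p k) = (\<Sum>k\<in>A. pderiv (p k))"
  by (induction A rule: infinite_finite_induct) (simp_all add: pderiv_add)

lemma poly_pderiv_taylor_poly:
  "poly (pderiv (taylor_poly a R n)) z = of_real R * (\<Sum>k\<le>n. diffs a k * (of_real R * z) ^ k)"
proof -
  have "poly (pderiv (taylor_poly a R n)) z = (\<Sum>k\<le>Suc n. of_nat k * (a k * of_real R ^ k) * z ^ (k - 1))"
    unfolding taylor_poly_def pderiv_sum pderiv_monom poly_sum poly_monom ..
  also have "\<dots> = (\<Sum>k\<le>n. of_nat (Suc k) * (a (Suc k) * of_real R ^ Suc k) * z ^ k)"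
    by (subst sum.atMost_Suc_shift) simp
  also have "\<dots> = of_real R * (\<Sum>k\<le>n. diffs a k * (of_real R * z) ^ k)"
    unfolding sum_distrib_left by (rule sum.cong) (auto simp: diffs_def power_mult_distrib mult_ac)
  finally show ?thesis .
qed

text \<open>
  For \<open>R < 1\<close> the Taylor series of the derivative of \<open>f(R z)\<close> converges uniformly on the unit disc, and \<open>u\<close> is
  bounded.
\<close>

lemma energy_form_taylor_poly_tendsto:
  assumes u: "u \<in> borel_measurable borel" "\<And>z. 0 \<le> u z \<and> u z \<le> M"
    and f: "disc_series a f" and R: "0 < R" "R < 1"
  shows "(\<lambda>n. energy_form u (taylor_poly a R n) (taylor_poly a R n))
           \<longlonglongrightarrow> (\<integral>z. u z * (norm (of_real R * disc_deriv f (of_real R * z)))\<^sup>2 \<partial>disc_measure)"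
  unfolding energy_form_self
proof (rule integral_dominated_convergence[where w = "\<lambda>_. M * (R * (\<Sum>k. norm (diffs a k * of_real R ^ k)))\<^sup>2"])
  have Rz: "norm (of_real R * z) < 1" if "norm z < 1" for z :: complex
    using R that mult_left_le_one_le[of "norm z" R] by (simp add: norm_mult)
  have sm: "summable (\<lambda>k. norm (diffs a k * of_real R ^ k))"
    using disc_series_abs_summable[OF f, of "of_real R"] R by simp
  note [measurable] = u(1) disc_deriv_measurable[OF f]
  show "(\<lambda>z. u z * (norm (of_real R * disc_deriv f (of_real R * z)))\<^sup>2) \<in> borel_measurable disc_measure" by measurable
  show "(\<lambda>z. u z * (norm (poly (pderiv (taylor_poly a R n)) z))\<^sup>2) \<in> borel_measurable disc_measure" for n
  proof -
    have [measurable]: "poly (pderiv (taylor_poly a R n)) \<in> borel_measurable borel" by (rule poly_measurable)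
    show ?thesis by measurable
  qed
  show "integrable disc_measure (\<lambda>_. M * (R * (\<Sum>k. norm (diffs a k * of_real R ^ k)))\<^sup>2)" by simp
  show "AE z in disc_measure. (\<lambda>n. u z * (norm (poly (pderiv (taylor_poly a R n)) z))\<^sup>2)
          \<longlonglongrightarrow> u z * (norm (of_real R * disc_deriv f (of_real R * z)))\<^sup>2"
  proof (rule AE_mp[OF AE_disc], rule AE_I2, rule impI)
    fix z :: complex assume "z \<in> ball 0 1"
    then have z: "norm (of_real R * z) < 1" using Rz by simp
    have "(\<lambda>n. \<Sum>k\<le>n. diffs a k * (of_real R * z) ^ k) \<longlonglongrightarrow> disc_deriv f (of_real R * z)"
      using disc_series_deriv[OF f z] z unfolding sums_def_le disc_deriv_def by simp
    then show "(\<lambda>n. u z * (norm (poly (pderiv (taylor_poly a R n)) z))\<^sup>2)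
          \<longlonglongrightarrow> u z * (norm (of_real R * disc_deriv f (of_real R * z)))\<^sup>2"
      unfolding poly_pderiv_taylor_poly by (intro tendsto_intros)
  qed
  show "AE z in disc_measure. norm (u z * (norm (poly (pderiv (taylor_poly a R n)) z))\<^sup>2)
          \<le> M * (R * (\<Sum>k. norm (diffs a k * of_real R ^ k)))\<^sup>2" for n
  proof (rule AE_mp[OF AE_disc], rule AE_I2, rule impI)
    fix z :: complex assume z: "z \<in> ball 0 1"
    have "norm (\<Sum>k\<le>n. diffs a k * (of_real R * z) ^ k) \<le> (\<Sum>k\<le>n. norm (diffs a k * of_real R ^ k))"
    proof (rule sum_norm_le)
      fix k
      have "norm z ^ k \<le> 1" using z by (simp add: power_le_one)
      then have "norm (diffs a k * of_real R ^ k) * norm z ^ k \<le> norm (diffs a k * of_real R ^ k)"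
        by (intro mult_left_le) auto
      then show "norm (diffs a k * (of_real R * z) ^ k) \<le> norm (diffs a k * of_real R ^ k)"
        by (simp add: norm_mult norm_power power_mult_distrib mult_ac)
    qed
    also have "\<dots> \<le> (\<Sum>k. norm (diffs a k * of_real R ^ k))"
      by (rule sum_le_suminf[OF sm]) auto
    finally have "norm (poly (pderiv (taylor_poly a R n)) z) \<le> R * (\<Sum>k. norm (diffs a k * of_real R ^ k))"
      unfolding poly_pderiv_taylor_poly using R by (simp add: norm_mult mult_left_mono)
    then have "u z * (norm (poly (pderiv (taylor_poly a R n)) z))\<^sup>2
        \<le> M * (R * (\<Sum>k. norm (diffs a k * of_real R ^ k)))\<^sup>2"
      using u(2)[of z] by (intro mult_mono power_mono) auto
    then show "norm (u z * (norm (poly (pderiv (taylor_poly a R n)) z))\<^sup>2)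
          \<le> M * (R * (\<Sum>k. norm (diffs a k * of_real R ^ k)))\<^sup>2"
      using u(2)[of z] by (simp add: abs_mult)
  qed
qed

section \<open>Truncation of superharmonic weights\<close>

definition truncated_weight :: "(complex \<Rightarrow> ereal) \<Rightarrow> nat \<Rightarrow> complex \<Rightarrow> real" where
  "truncated_weight \<omega> n z = (if z \<in> ball 0 1 then enn2real (min (e2ennreal (\<omega> z)) (of_nat n)) else 0)"

definition disc_weight :: "(complex \<Rightarrow> ereal) \<Rightarrow> complex \<Rightarrow> ennreal" where
  "disc_weight \<omega> z = (if z \<in> ball 0 1 then e2ennreal (\<omega> z) else 0)"

lemma ennreal_truncated_weight: "ennreal (truncated_weight \<omega> n z) = min (disc_weight \<omega> z) (of_nat n)"
  unfolding truncated_weight_def disc_weight_def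
  by (auto simp: ennreal_enn2real_if min_def top_unique ennreal_of_nat_eq_real_of_nat)

lemma disc_weight_measurable:
  assumes "superharmonic_weight \<omega>"
  shows "disc_weight \<omega> \<in> borel_measurable borel"
proof -
  define v where "v z = (if z \<in> ball 0 1 then \<omega> z else 0)" for z
  have "v \<in> borel_measurable borel"
  proof (rule borel_measurableI_greater)
    fix y :: ereal
    have "open {z \<in> ball 0 1. y < \<omega> z}"
      using assms by (simp add: superharmonic_weight_def superharmonic_on_def)
    then have "{z \<in> ball 0 1. y < \<omega> z} \<in> sets borel" by (rule borel_open)
    moreover have "{z \<in> space borel. y < v z}
        = {z \<in> ball 0 1. y < \<omega> z} \<union> (if y < 0 then - ball 0 1 else {})"
      by (auto simp: v_def)
    ultimately show "{z \<in> space borel. y < v z} \<in> sets borel" by auto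
  qed
  then have "(\<lambda>z. e2ennreal (v z)) \<in> borel_measurable borel" by measurable
  also have "(\<lambda>z. e2ennreal (v z)) = disc_weight \<omega>"
    by (auto simp: v_def disc_weight_def fun_eq_iff zero_ennreal.abs_eq[symmetric] e2ennreal_neg)
  finally show ?thesis .
qed

lemma truncated_weight_bounds: "0 \<le> truncated_weight \<omega> n z" "truncated_weight \<omega> n z \<le> real n"
proof -
  show "0 \<le> truncated_weight \<omega> n z" by (simp add: truncated_weight_def)
  have "ennreal (truncated_weight \<omega> n z) \<le> ennreal (real n)"
    unfolding ennreal_truncated_weight by (simp add: ennreal_of_nat_eq_real_of_nat)
  then show "truncated_weight \<omega> n z \<le> real n" by (simp add: ennreal_le_iff)
qed

text \<open>
  The circle integral of \<open>min \<omega> n\<close> is at most that of \<open>\<omega>\<close> and at most \<open>2 \<pi> n\<close>. At a centre where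
  \<open>\<omega>\<close> is infinite only the second bound is informative, and it suffices.
\<close>

lemma truncated_weight_bounded_superharmonic:
  assumes "superharmonic_weight \<omega>"
  shows "bounded_superharmonic (truncated_weight \<omega> n)"
  unfolding bounded_superharmonic_def
proof (intro conjI allI impI)
  have "(\<lambda>z. enn2real (min (disc_weight \<omega> z) (of_nat n))) \<in> borel_measurable borel"
    using disc_weight_measurable[OF assms] by measurable
  also have "(\<lambda>z. enn2real (min (disc_weight \<omega> z) (of_nat n))) = truncated_weight \<omega> n"
    by (auto simp: disc_weight_def truncated_weight_def fun_eq_iff)
  finally show meas: "truncated_weight \<omega> n \<in> borel_measurable borel" .
  show "\<exists>M. \<forall>z. 0 \<le> truncated_weight \<omega> n z \<and> truncated_weight \<omega> n z \<le> M"
    using truncated_weight_bounds by blast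
  fix w :: complex and r :: real
  assume r: "0 < r" "cball w r \<subseteq> ball 0 1"
  then have w: "w \<in> ball 0 1" by (intro subsetD[OF r(2)]) simp
  have on_circle: "w + of_real r * cis t \<in> ball 0 1" for t
    using r by (intro subsetD[OF r(2)]) (simp add: dist_norm norm_mult)
  have \<omega>_pos: "0 < \<omega> z" if "z \<in> ball 0 1" for z
    using assms that by (simp add: superharmonic_weight_def)
  note [measurable] = meas
  have le_n: "(\<integral>\<^sup>+ t. ennreal (truncated_weight \<omega> n (w + of_real r * cis t)) \<partial>angle_measure) \<le> ennreal (2 * pi * real n)"
  proof -
    have "(\<integral>\<^sup>+ t. ennreal (truncated_weight \<omega> n (w + of_real r * cis t)) \<partial>angle_measure) \<le> (\<integral>\<^sup>+ t. ennreal (real n) \<partial>angle_measure)"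
      by (intro nn_integral_mono ennreal_leI truncated_weight_bounds)
    also have "\<dots> = ennreal (2 * pi * real n)"
      using emeasure_angle_measure by (simp add: ennreal_mult mult.commute)
    finally show ?thesis .
  qed
  show "(\<integral>\<^sup>+ t. ennreal (truncated_weight \<omega> n (w + of_real r * cis t)) \<partial>angle_measure)
          \<le> ennreal (2 * pi * truncated_weight \<omega> n w)"
  proof (cases "\<omega> w = \<infinity>")
    case True
    then have "truncated_weight \<omega> n w = real n"
      using w by (simp add: truncated_weight_def e2ennreal_infty)
    then show ?thesis using le_n by simp
  next
    case False
    then obtain x where x: "\<omega> w = ereal x" "0 < x"
      using \<omega>_pos[OF w] by (cases "\<omega> w") auto
    define J where "J = (\<integral>\<^sup>+ t\<in>{0..2 * pi}. e2ennreal (\<omega> (w + of_real r * cis t)) \<partial>lborel)"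
    have "(\<integral>\<^sup>+ t\<in>{0..2 * pi}. e2ennreal (- \<omega> (w + of_real r * cis t)) \<partial>lborel) = 0"
    proof -
      have "e2ennreal (- \<omega> (w + of_real r * cis t)) = 0" for t
        using \<omega>_pos[OF on_circle[of t]] by (intro e2ennreal_neg) (simp add: ereal_uminus_le_0_iff less_imp_le)
      then show ?thesis by simp
    qed
    moreover have "circle_mean \<omega> w r \<le> \<omega> w"
      using assms r unfolding superharmonic_weight_def superharmonic_on_def by blast
    ultimately have "enn2ereal J / ereal (2 * pi) \<le> ereal x"
      unfolding circle_mean_def J_def x(1) by (simp add: zero_ennreal.rep_eq)
    then have "enn2ereal J \<le> ereal (2 * pi * x)"
      by (cases "enn2ereal J") (auto simp: field_simps)
    then have "e2ennreal (enn2ereal J) \<le> e2ennreal (ereal (2 * pi * x))" by (rule e2ennreal_mono)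
    then have J: "J \<le> ennreal (2 * pi * x)" by simp
    have "(\<integral>\<^sup>+ t. ennreal (truncated_weight \<omega> n (w + of_real r * cis t)) \<partial>angle_measure)
        = (\<integral>\<^sup>+ t\<in>{0..2 * pi}. ennreal (truncated_weight \<omega> n (w + of_real r * cis t)) \<partial>lborel)"
      by (rule nn_integral_angle_measure) measurable
    also have "\<dots> \<le> J"
      unfolding J_def ennreal_truncated_weight disc_weight_def
      by (intro nn_integral_mono mult_right_mono) (use on_circle in auto)
    also note J
    finally have le_x: "(\<integral>\<^sup>+ t. ennreal (truncated_weight \<omega> n (w + of_real r * cis t)) \<partial>angle_measure) \<le> ennreal (2 * pi * x)" .
    have "min (ennreal x) (ennreal (real n)) = ennreal (min x (real n))"
      using x by (simp add: min_def ennreal_le_iff)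
    then have "truncated_weight \<omega> n w = min x (real n)"
      using w x by (simp add: truncated_weight_def ennreal_of_nat_eq_real_of_nat)
    then show ?thesis using le_n le_x by (simp add: min_def)
  qed
qed

lemma bounded_superharmonic_dilate:
  assumes u: "bounded_superharmonic u" and R: "0 < R" "R \<le> 1"
  shows "bounded_superharmonic (\<lambda>z. u (of_real R * z))"
  unfolding bounded_superharmonic_def
proof (intro conjI allI impI)
  have [measurable]: "u \<in> borel_measurable borel" using u by (simp add: bounded_superharmonic_def)
  show "(\<lambda>z. u (of_real R * z)) \<in> borel_measurable borel" by measurable
  show "\<exists>M. \<forall>z. 0 \<le> u (of_real R * z) \<and> u (of_real R * z) \<le> M"
    using u by (auto simp: bounded_superharmonic_def)
  fix w :: complex and r :: real
  assume r: "0 < r" "cball w r \<subseteq> ball 0 1"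
  have "cball (of_real R * w) (R * r) \<subseteq> ball 0 1"
  proof
    fix z assume z: "z \<in> cball (of_real R * w) (R * r)"
    have "of_real R * w - z = of_real R * (w - z / of_real R)"
      using R by (simp add: right_diff_distrib)
    then have "norm (of_real R * w - z) = R * norm (w - z / of_real R)"
      using R by (simp add: norm_mult)
    then have "z / of_real R \<in> cball w r"
      using z R by (simp add: dist_norm)
    then have "norm (z / of_real R) < 1" using r by auto
    then show "z \<in> ball 0 1" using R by (simp add: norm_divide field_simps)
  qed
  then have "(\<integral>\<^sup>+ t. ennreal (u (of_real R * w + of_real (R * r) * cis t)) \<partial>angle_measure) \<le> ennreal (2 * pi * u (of_real R * w))"
    using u R r unfolding bounded_superharmonic_def by (metis mult_pos_pos)
  then show "(\<integral>\<^sup>+ t. ennreal (u (of_real R * (w + of_real r * cis t))) \<partial>angle_measure) \<le> ennreal (2 * pi * u (of_real R * w))"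
    by (simp add: distrib_left mult.assoc)
qed

section \<open>Multiplier bounds on weighted Dirichlet spaces\<close>

definition weighted_sq_integral :: "(complex \<Rightarrow> ereal) \<Rightarrow> (complex \<Rightarrow> complex) \<Rightarrow> ennreal" where
  "weighted_sq_integral \<omega> F = (\<integral>\<^sup>+ z. ennreal ((norm (F z))\<^sup>2) * disc_weight \<omega> z \<partial>lborel)"

lemma dirichlet_integral_eq_weighted_sq_integral: "dirichlet_integral \<omega> f = ennreal (1 / pi) * weighted_sq_integral \<omega> (disc_deriv f)"
proof -
  have "(\<integral>\<^sup>+ z\<in>ball 0 1. ennreal ((norm (deriv f z))\<^sup>2) * e2ennreal (\<omega> z) \<partial>lborel) = weighted_sq_integral \<omega> (disc_deriv f)"
    unfolding weighted_sq_integral_def by (rule nn_integral_cong) (simp add: disc_deriv_def disc_weight_def indicator_def)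
  then show ?thesis unfolding dirichlet_integral_def by simp
qed

definition energy_form_multiplier :: "(nat \<Rightarrow> real) \<Rightarrow> real \<Rightarrow> bool" where
  "energy_form_multiplier c \<kappa> \<longleftrightarrow> 0 \<le> \<kappa> \<and>
     (\<forall>u p. bounded_superharmonic u \<longrightarrow> energy_form u (hadamard c p) (hadamard c p) \<le> \<kappa> * energy_form u p p)"

lemma nn_integral_scale:
  fixes f :: "complex \<Rightarrow> ennreal"
  assumes f: "f \<in> borel_measurable borel" and R: "0 < R"
  shows "(\<integral>\<^sup>+ z. ennreal (R\<^sup>2) * f (of_real R * z) \<partial>lborel) = (\<integral>\<^sup>+ z. f z \<partial>lborel)"
proof -
  have *: "(lborel :: complex measure) = density (distr lborel borel (\<lambda>x. 0 + R *\<^sub>R x)) (\<lambda>_. ennreal (\<bar>R\<bar> ^ DIM(complex)))"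
    using R by (intro lborel_affine) simp
  have "(\<integral>\<^sup>+ z. f z \<partial>lborel) = (\<integral>\<^sup>+ z. f z \<partial>density (distr lborel borel (\<lambda>x. 0 + R *\<^sub>R x)) (\<lambda>_. ennreal (\<bar>R\<bar> ^ DIM(complex))))"
    using * by metis
  also have "\<dots> = (\<integral>\<^sup>+ z. ennreal (\<bar>R\<bar> ^ DIM(complex)) * f z \<partial>distr lborel borel (\<lambda>x. 0 + R *\<^sub>R x))"
    using f by (intro nn_integral_density) auto
  also have "\<dots> = (\<integral>\<^sup>+ z. ennreal (\<bar>R\<bar> ^ DIM(complex)) * f (0 + R *\<^sub>R z) \<partial>lborel)"
    using f by (intro nn_integral_distr) auto
  finally show ?thesis by (simp add: scaleR_conv_of_real)
qed

text \<open>
  Replacing a weight and a function by their dilates turns integrals over the smaller disc of radius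
  \<open>R\<close> into integrals over the unit disc, where the polynomial estimates live.
\<close>

lemma disc_integral_dilated:
  assumes u: "bounded_superharmonic u" and f: "disc_series a f" and R: "0 < R" "R < 1"
  shows "ennreal (\<integral>z. u (of_real R * z) * (norm (of_real R * disc_deriv f (of_real R * z)))\<^sup>2 \<partial>disc_measure)
           = (\<integral>\<^sup>+ z\<in>ball 0 R. ennreal (u z * (norm (disc_deriv f z))\<^sup>2) \<partial>lborel)"
proof -
  obtain M where um [measurable]: "u \<in> borel_measurable borel" and uM: "\<And>z. 0 \<le> u z \<and> u z \<le> M"
    using bounded_superharmonicD[OF u] by blast
  note [measurable] = disc_deriv_measurable[OF f]
  define h where "h z = u (of_real R * z) * (norm (of_real R * disc_deriv f (of_real R * z)))\<^sup>2" for z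
  have hm [measurable]: "h \<in> borel_measurable borel" unfolding h_def by measurable
  have h0: "0 \<le> h z" for z unfolding h_def using uM by simp
  have "continuous_on (ball 0 1) (deriv f)"
    by (intro holomorphic_on_imp_continuous_on holomorphic_deriv disc_series_imp_holomorphic[OF f]) simp
  then have "continuous_on (cball 0 R) (deriv f)"
    by (rule continuous_on_subset) (use R in auto)
  from continuous_on_cball_bounded[OF this] obtain B where B: "\<forall>z\<in>cball 0 R. norm (deriv f z) \<le> B" by blast
  have "integrable disc_measure h"
  proof (rule disc_integrable[where B = "M * (R * B)\<^sup>2"])
    fix z :: complex assume z: "norm z < 1"
    have "R * norm z \<le> R" "R * norm z < 1" using z R by (auto simp: mult_left_le intro: le_less_trans[of _ R])
    then have "norm (disc_deriv f (of_real R * z)) \<le> B"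
      using B R by (auto simp: disc_deriv_def norm_mult)
    then have "norm (of_real R * disc_deriv f (of_real R * z)) \<le> R * B"
      using R by (simp add: norm_mult mult_left_mono)
    then have "h z \<le> M * (R * B)\<^sup>2"
      unfolding h_def using uM by (intro mult_mono power_mono) (auto intro: order_trans)
    then show "norm (h z) \<le> M * (R * B)\<^sup>2" using h0[of z] by simp
  qed (rule hm)
  then have "ennreal (\<integral>z. h z \<partial>disc_measure) = (\<integral>\<^sup>+ z. ennreal (h z) \<partial>disc_measure)"
    by (intro nn_integral_eq_integral[symmetric]) (auto simp: h0)
  also have "\<dots> = (\<integral>\<^sup>+ z\<in>ball 0 1. ennreal (h z) \<partial>lborel)"
    by (rule nn_integral_disc_measure) measurable
  also have "\<dots> = (\<integral>\<^sup>+ z. ennreal (R\<^sup>2) * (ennreal (u (of_real R * z) * (norm (disc_deriv f (of_real R * z)))\<^sup>2)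
                        * indicator (ball 0 R) (of_real R * z)) \<partial>lborel)"
  proof (rule nn_integral_cong)
    fix z :: complex
    have "indicator (ball 0 R) (of_real R * z) = (indicator (ball 0 1) z :: ennreal)"
      using R by (auto simp: indicator_def norm_mult)
    moreover have "ennreal (h z) = ennreal (R\<^sup>2) * ennreal (u (of_real R * z) * (norm (disc_deriv f (of_real R * z)))\<^sup>2)"
      unfolding h_def using R uM by (subst ennreal_mult[symmetric]) (auto simp: norm_mult power_mult_distrib mult_ac)
    ultimately show "ennreal (h z) * indicator (ball 0 1) z = ennreal (R\<^sup>2) * (ennreal (u (of_real R * z) * (norm (disc_deriv f (of_real R * z)))\<^sup>2)
                        * indicator (ball 0 R) (of_real R * z))"
      by (simp add: mult.assoc)
  qed
  also have "\<dots> = (\<integral>\<^sup>+ z\<in>ball 0 R. ennreal (u z * (norm (disc_deriv f z))\<^sup>2) \<partial>lborel)"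
    by (rule nn_integral_scale[OF _ R(1)]) (intro borel_measurable_times_ennreal borel_measurable_indicator; measurable)
  finally show ?thesis unfolding h_def .
qed

lemma multiplier_bound_truncated:
  assumes c: "energy_form_multiplier c \<kappa>" and u: "bounded_superharmonic u"
    and f: "disc_series a f" and g: "disc_series (\<lambda>k. of_real (c k) * a k) g" and R: "0 < R" "R < 1"
  shows "(\<integral>\<^sup>+ z\<in>ball 0 R. ennreal (u z * (norm (disc_deriv g z))\<^sup>2) \<partial>lborel)
           \<le> ennreal \<kappa> * (\<integral>\<^sup>+ z\<in>ball 0 R. ennreal (u z * (norm (disc_deriv f z))\<^sup>2) \<partial>lborel)"
proof -
  have \<kappa>: "0 \<le> \<kappa>" using c by (simp add: energy_form_multiplier_def)
  define v where "v z = u (of_real R * z)" for z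
  have v: "bounded_superharmonic v"
    unfolding v_def using R by (intro bounded_superharmonic_dilate[OF u]) auto
  obtain M where vM: "v \<in> borel_measurable borel" "\<And>z. 0 \<le> v z \<and> v z \<le> M"
    using bounded_superharmonicD[OF v] by blast
  have le: "energy_form v (taylor_poly (\<lambda>k. of_real (c k) * a k) R n) (taylor_poly (\<lambda>k. of_real (c k) * a k) R n)
     \<le> \<kappa> * energy_form v (taylor_poly a R n) (taylor_poly a R n)" for n
    using c v unfolding energy_form_multiplier_def hadamard_taylor_poly[symmetric] by blast
  have "(\<integral>z. v z * (norm (of_real R * disc_deriv g (of_real R * z)))\<^sup>2 \<partial>disc_measure)
       \<le> \<kappa> * (\<integral>z. v z * (norm (of_real R * disc_deriv f (of_real R * z)))\<^sup>2 \<partial>disc_measure)"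
  proof (rule LIMSEQ_le)
    show "(\<lambda>n. energy_form v (taylor_poly (\<lambda>k. of_real (c k) * a k) R n) (taylor_poly (\<lambda>k. of_real (c k) * a k) R n))
       \<longlonglongrightarrow> (\<integral>z. v z * (norm (of_real R * disc_deriv g (of_real R * z)))\<^sup>2 \<partial>disc_measure)"
      by (rule energy_form_taylor_poly_tendsto[OF vM g R])
    show "(\<lambda>n. \<kappa> * energy_form v (taylor_poly a R n) (taylor_poly a R n))
       \<longlonglongrightarrow> \<kappa> * (\<integral>z. v z * (norm (of_real R * disc_deriv f (of_real R * z)))\<^sup>2 \<partial>disc_measure)"
      by (intro tendsto_mult tendsto_const energy_form_taylor_poly_tendsto[OF vM f R])
    show "\<exists>N. \<forall>n\<ge>N. energy_form v (taylor_poly (\<lambda>k. of_real (c k) * a k) R n) (taylor_poly (\<lambda>k. of_real (c k) * a k) R n)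
     \<le> \<kappa> * energy_form v (taylor_poly a R n) (taylor_poly a R n)"
      by (intro exI[of _ 0] allI impI le)
  qed
  then have "ennreal (\<integral>z. v z * (norm (of_real R * disc_deriv g (of_real R * z)))\<^sup>2 \<partial>disc_measure)
       \<le> ennreal (\<kappa> * (\<integral>z. v z * (norm (of_real R * disc_deriv f (of_real R * z)))\<^sup>2 \<partial>disc_measure))"
    by (rule ennreal_leI)
  also have "\<dots> = ennreal \<kappa> * ennreal (\<integral>z. v z * (norm (of_real R * disc_deriv f (of_real R * z)))\<^sup>2 \<partial>disc_measure)"
    using \<kappa> vM(2) by (intro ennreal_mult) (auto intro!: integral_nonneg_AE)
  finally show ?thesis
    unfolding v_def disc_integral_dilated[OF u f R] disc_integral_dilated[OF u g R] .
qed

text \<open>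
  The truncated weights increase to \<open>\<omega>\<close> and the discs of radius \<open>R\<^sub>n\<close> increase to the unit disc, so
  Fatou's lemma removes both restrictions from the previous bound.
\<close>

theorem multiplier_bound:
  assumes c: "energy_form_multiplier c \<kappa>" and \<omega>: "superharmonic_weight \<omega>"
    and f: "disc_series a f" and g: "disc_series (\<lambda>k. of_real (c k) * a k) g"
  shows "weighted_sq_integral \<omega> (disc_deriv g) \<le> ennreal \<kappa> * weighted_sq_integral \<omega> (disc_deriv f)"
proof -
  define R where "R n = 1 - inverse (real (Suc (Suc n)))" for n
  have R: "0 < R n" "R n < 1" for n by (auto simp: R_def field_simps)
  have R_lim: "R \<longlonglongrightarrow> 1"
    unfolding R_def using tendsto_diff[OF tendsto_const LIMSEQ_Suc[OF LIMSEQ_inverse_real_of_nat], of 1] by simp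
  define T where "T f n z = ennreal (truncated_weight \<omega> n z * (norm (disc_deriv f z))\<^sup>2) * indicator (ball 0 (R n)) z" for f n z
  have T_eq: "T f n z = ennreal ((norm (disc_deriv f z))\<^sup>2) * min (disc_weight \<omega> z) (of_nat n) * indicator (ball 0 (R n)) z" for f n z
    unfolding T_def ennreal_truncated_weight[symmetric]
    by (subst ennreal_mult) (auto simp: truncated_weight_bounds mult.commute)
  have T_le: "T f n z \<le> ennreal ((norm (disc_deriv f z))\<^sup>2) * disc_weight \<omega> z" for f n z
    unfolding T_eq by (auto simp: indicator_def intro!: mult_left_mono)
  have T_lim: "(\<lambda>n. T g n z) \<longlonglongrightarrow> ennreal ((norm (disc_deriv g z))\<^sup>2) * disc_weight \<omega> z" for z
  proof (cases "z \<in> ball 0 1")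
    case True
    have "(\<lambda>n. min (disc_weight \<omega> z) (of_nat n)) \<longlonglongrightarrow> min (disc_weight \<omega> z) top"
      by (intro tendsto_min tendsto_const of_nat_tendsto_top_ennreal)
    then have "(\<lambda>n. min (disc_weight \<omega> z) (of_nat n)) \<longlonglongrightarrow> disc_weight \<omega> z" by (simp add: min_absorb1)
    then have "(\<lambda>n. ennreal ((norm (disc_deriv g z))\<^sup>2) * min (disc_weight \<omega> z) (of_nat n)) \<longlonglongrightarrow> ennreal ((norm (disc_deriv g z))\<^sup>2) * disc_weight \<omega> z"
      by (intro ennreal_tendsto_cmult) auto
    moreover have "\<forall>\<^sub>F n in sequentially. ennreal ((norm (disc_deriv g z))\<^sup>2) * min (disc_weight \<omega> z) (of_nat n) = T g n z"
      using order_tendstoD(1)[OF R_lim, of "norm z"] True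
      by (auto elim!: eventually_mono simp: T_eq)
    ultimately show ?thesis by (rule Lim_transform_eventually)
  next
    case False
    then have "T g n z = 0" for n unfolding T_eq by (simp add: disc_weight_def)
    then show ?thesis using False by (simp add: disc_weight_def)
  qed
  have [measurable]: "truncated_weight \<omega> n \<in> borel_measurable borel" for n
    using truncated_weight_bounded_superharmonic[OF \<omega>] by (simp add: bounded_superharmonic_def)
  note [measurable] = disc_deriv_measurable[OF g]
  have Tm: "T g n \<in> borel_measurable lborel" for n
  proof -
    have "(\<lambda>z. ennreal (truncated_weight \<omega> n z * (norm (disc_deriv g z))\<^sup>2) * indicator (ball 0 (R n)) z) \<in> borel_measurable borel"
      by (intro borel_measurable_times_ennreal borel_measurable_indicator; measurable)
    then show ?thesis unfolding T_def by simp
  qed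
  have bound: "(\<integral>\<^sup>+ z. T g n z \<partial>lborel) \<le> ennreal \<kappa> * weighted_sq_integral \<omega> (disc_deriv f)" for n
  proof -
    have "(\<integral>\<^sup>+ z. T g n z \<partial>lborel) \<le> ennreal \<kappa> * (\<integral>\<^sup>+ z. T f n z \<partial>lborel)"
      unfolding T_def
      by (rule multiplier_bound_truncated[OF c truncated_weight_bounded_superharmonic[OF \<omega>] f g R])
    also have "\<dots> \<le> ennreal \<kappa> * weighted_sq_integral \<omega> (disc_deriv f)"
      unfolding weighted_sq_integral_def by (intro mult_left_mono nn_integral_mono T_le) auto
    finally show ?thesis .
  qed
  have "weighted_sq_integral \<omega> (disc_deriv g) = (\<integral>\<^sup>+ z. liminf (\<lambda>n. T g n z) \<partial>lborel)"
    unfolding weighted_sq_integral_def using lim_imp_Liminf[OF _ T_lim] by simp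
  also have "\<dots> \<le> liminf (\<lambda>n. \<integral>\<^sup>+ z. T g n z \<partial>lborel)"
    using Tm by (rule nn_integral_liminf)
  also have "\<dots> \<le> ennreal \<kappa> * weighted_sq_integral \<omega> (disc_deriv f)"
  proof -
    have "liminf (\<lambda>n. \<integral>\<^sup>+ z. T g n z \<partial>lborel) \<le> liminf (\<lambda>n. ennreal \<kappa> * weighted_sq_integral \<omega> (disc_deriv f))"
      by (intro Liminf_mono always_eventually allI bound)
    then show ?thesis by (simp add: Liminf_const)
  qed
  finally show ?thesis .
qed

lemma finite_multiplier:
  assumes "\<And>j. \<bar>c j\<bar> \<le> 1" "\<And>j. j > n \<Longrightarrow> c j = 0"
    and "real n * (\<Sum>j\<le>n. (c (Suc j) - c j)\<^sup>2) \<le> C"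
  shows "energy_form_multiplier c (2 + 2 * C)"
  unfolding energy_form_multiplier_def
proof (intro conjI allI impI)
  have "0 \<le> real n * (\<Sum>j\<le>n. (c (Suc j) - c j)\<^sup>2)" by (intro mult_nonneg_nonneg sum_nonneg) auto
  then show "0 \<le> 2 + 2 * C" using assms(3) by simp
  fix u p assume u: "bounded_superharmonic u"
  then interpret concave_shift_form "energy_form u" by (rule energy_form_concave_shift_form)
  have "0 \<le> energy_form u p p"
    unfolding energy_form_self using u by (auto simp: bounded_superharmonic_def intro!: integral_nonneg_AE)
  then have "(2 + 2 * real n * (\<Sum>j\<le>n. (c (Suc j) - c j)\<^sup>2)) * energy_form u p p \<le> (2 + 2 * C) * energy_form u p p"
    using assms(3) by (intro mult_right_mono) auto
  with hadamard_bound[of c n p] assms(1,2)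
  show "energy_form u (hadamard c p) (hadamard c p) \<le> (2 + 2 * C) * energy_form u p p" by fastforce
qed

lemma dilation_multiplier:
  assumes "0 < \<rho>" "\<rho> < 1"
  shows "energy_form_multiplier (\<lambda>j. \<rho> ^ j) 1"
  unfolding energy_form_multiplier_def
proof (intro conjI allI impI)
  fix u p assume "bounded_superharmonic u"
  then interpret concave_shift_form "energy_form u" by (rule energy_form_concave_shift_form)
  show "energy_form u (hadamard (\<lambda>j. \<rho> ^ j) p) (hadamard (\<lambda>j. \<rho> ^ j) p) \<le> 1 * energy_form u p p"
    using dilation_bound[OF assms] by simp
qed simp

section \<open>Approximation by dilates\<close>

lemma weighted_sq_integral_mono:
  assumes "\<And>z. norm (F z) \<le> C * norm (G z)" "0 \<le> C"
    and "G \<in> borel_measurable borel" "superharmonic_weight \<omega>"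
  shows "weighted_sq_integral \<omega> F \<le> ennreal (C\<^sup>2) * weighted_sq_integral \<omega> G"
proof -
  note [measurable] = assms(3) disc_weight_measurable[OF assms(4)]
  have "weighted_sq_integral \<omega> F \<le> (\<integral>\<^sup>+ z. ennreal (C\<^sup>2) * (ennreal ((norm (G z))\<^sup>2) * disc_weight \<omega> z) \<partial>lborel)"
    unfolding weighted_sq_integral_def
  proof (rule nn_integral_mono)
    fix z
    have "(norm (F z))\<^sup>2 \<le> C\<^sup>2 * (norm (G z))\<^sup>2"
      unfolding power_mult_distrib[symmetric] using assms(1) by (intro power_mono) auto
    then have "ennreal ((norm (F z))\<^sup>2) \<le> ennreal (C\<^sup>2) * ennreal ((norm (G z))\<^sup>2)"
      by (simp add: ennreal_mult[symmetric] ennreal_leI)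
    then show "ennreal ((norm (F z))\<^sup>2) * disc_weight \<omega> z \<le> ennreal (C\<^sup>2) * (ennreal ((norm (G z))\<^sup>2) * disc_weight \<omega> z)"
      unfolding mult.assoc[symmetric] by (rule mult_right_mono) simp
  qed
  also have "\<dots> = ennreal (C\<^sup>2) * weighted_sq_integral \<omega> G"
    unfolding weighted_sq_integral_def by (rule nn_integral_cmult) measurable
  finally show ?thesis .
qed

lemma weighted_sq_integral_parallelogram:
  assumes "F \<in> borel_measurable borel" "G \<in> borel_measurable borel" "superharmonic_weight \<omega>"
  shows "weighted_sq_integral \<omega> (\<lambda>z. F z - G z) + weighted_sq_integral \<omega> (\<lambda>z. F z + G z) = 2 * weighted_sq_integral \<omega> F + 2 * weighted_sq_integral \<omega> G"
proof -
  note [measurable] = assms(1,2) disc_weight_measurable[OF assms(3)]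
  have pl: "(norm (a - b))\<^sup>2 + (norm (a + b))\<^sup>2 = 2 * (norm a)\<^sup>2 + 2 * (norm b)\<^sup>2" for a b :: complex
    unfolding cmod_power2 by (simp add: power2_eq_square algebra_simps)
  have "weighted_sq_integral \<omega> (\<lambda>z. F z - G z) + weighted_sq_integral \<omega> (\<lambda>z. F z + G z)
      = (\<integral>\<^sup>+ z. ennreal ((norm (F z - G z))\<^sup>2) * disc_weight \<omega> z + ennreal ((norm (F z + G z))\<^sup>2) * disc_weight \<omega> z \<partial>lborel)"
    unfolding weighted_sq_integral_def by (rule nn_integral_add[symmetric]) measurable
  also have "\<dots> = (\<integral>\<^sup>+ z. 2 * (ennreal ((norm (F z))\<^sup>2) * disc_weight \<omega> z) + 2 * (ennreal ((norm (G z))\<^sup>2) * disc_weight \<omega> z) \<partial>lborel)"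
  proof (rule nn_integral_cong)
    fix z
    have "ennreal ((norm (F z - G z))\<^sup>2) + ennreal ((norm (F z + G z))\<^sup>2)
        = ennreal ((norm (F z - G z))\<^sup>2 + (norm (F z + G z))\<^sup>2)" by (rule ennreal_plus[symmetric]) auto
    also have "\<dots> = 2 * ennreal ((norm (F z))\<^sup>2) + 2 * ennreal ((norm (G z))\<^sup>2)"
      unfolding pl by (simp add: ennreal_plus ennreal_mult)
    finally show "ennreal ((norm (F z - G z))\<^sup>2) * disc_weight \<omega> z + ennreal ((norm (F z + G z))\<^sup>2) * disc_weight \<omega> z
        = 2 * (ennreal ((norm (F z))\<^sup>2) * disc_weight \<omega> z) + 2 * (ennreal ((norm (G z))\<^sup>2) * disc_weight \<omega> z)"
      by (simp add: distrib_right[symmetric] mult.assoc[symmetric])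
  qed
  also have "\<dots> = 2 * weighted_sq_integral \<omega> F + 2 * weighted_sq_integral \<omega> G"
    unfolding weighted_sq_integral_def by (simp add: nn_integral_add nn_integral_cmult)
  finally show ?thesis .
qed

lemma weighted_sq_integral_add_le:
  assumes "F \<in> borel_measurable borel" "G \<in> borel_measurable borel" "superharmonic_weight \<omega>"
  shows "weighted_sq_integral \<omega> (\<lambda>z. F z + G z) \<le> 2 * weighted_sq_integral \<omega> F + 2 * weighted_sq_integral \<omega> G"
  unfolding weighted_sq_integral_parallelogram[OF assms, symmetric] by simp

lemma disc_deriv_diff:
  assumes "disc_series a f" "disc_series b g"
  shows "disc_deriv (\<lambda>z. f z - g z) z = disc_deriv f z - disc_deriv g z"
proof (cases "norm z < 1")
  case True
  have "deriv (\<lambda>z. f z - g z) z = deriv f z - deriv g z"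
    using disc_series_has_derivative[OF assms(1) True] disc_series_has_derivative[OF assms(2) True]
    by (intro deriv_diff) (auto simp: field_differentiable_def)
  then show ?thesis by (simp add: disc_deriv_def scaleR_right_diff_distrib)
qed (simp add: disc_deriv_def)

text \<open>
  Let \<open>x\<close> be the energy of \<open>f\<close>. The energies of the dilates \<open>f\<^sub>n\<close> are at most \<open>x\<close>, so by the
  parallelogram law the energies of \<open>f\<^sub>n - f\<close> and \<open>f\<^sub>n + f\<close> add up to at most \<open>4 x\<close>. By Fatou's lemma the
  energy of \<open>f\<^sub>n + f\<close> is asymptotically at least \<open>4 x\<close>, which forces that of \<open>f\<^sub>n - f\<close> to be small.
\<close>

lemma dilates_approximate:
  assumes \<omega>: "superharmonic_weight \<omega>" and f: "disc_series a f" and fin: "weighted_sq_integral \<omega> (disc_deriv f) < \<infinity>" and \<eta>: "0 < \<eta>"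
  obtains \<rho> where "0 < \<rho>" "\<rho> < 1" "weighted_sq_integral \<omega> (disc_deriv (\<lambda>z. f (of_real \<rho> * z) - f z)) \<le> ennreal \<eta>"
proof -
  define \<rho> where "\<rho> n = 1 - inverse (real (Suc (Suc n)))" for n
  have \<rho>: "0 < \<rho> n" "\<rho> n < 1" for n by (auto simp: \<rho>_def field_simps)
  have \<rho>_lim: "\<rho> \<longlonglongrightarrow> 1"
    unfolding \<rho>_def using tendsto_diff[OF tendsto_const LIMSEQ_Suc[OF LIMSEQ_inverse_real_of_nat], of 1] by simp
  define F where "F n z = f (of_real (\<rho> n) * z)" for n z
  have F: "disc_series (\<lambda>k. of_real (\<rho> n ^ k) * a k) (F n)" for n
    unfolding F_def using \<rho>[of n] by (intro disc_series_dilate[OF f]) auto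
  note fm = disc_deriv_measurable[OF f]
  note Fm = disc_deriv_measurable[OF F]
  note [measurable] = fm Fm disc_weight_measurable[OF \<omega>]
  have F_le: "weighted_sq_integral \<omega> (disc_deriv (F n)) \<le> weighted_sq_integral \<omega> (disc_deriv f)" for n
    using multiplier_bound[OF dilation_multiplier[OF \<rho>] \<omega> f F] by simp
  obtain x where x: "0 \<le> x" "weighted_sq_integral \<omega> (disc_deriv f) = ennreal x"
    using fin by (cases "weighted_sq_integral \<omega> (disc_deriv f)") auto
  have sum_le: "weighted_sq_integral \<omega> (\<lambda>z. disc_deriv (F n) z - disc_deriv f z) + weighted_sq_integral \<omega> (\<lambda>z. disc_deriv (F n) z + disc_deriv f z) \<le> ennreal (4 * x)" for n
  proof -
    have "2 * weighted_sq_integral \<omega> (disc_deriv (F n)) + 2 * weighted_sq_integral \<omega> (disc_deriv f) \<le> 2 * ennreal x + 2 * ennreal x"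
      using F_le[of n] x by (intro add_mono mult_left_mono) auto
    also have "\<dots> = ennreal (4 * x)"
      using x by (simp add: ennreal_mult distrib_right[symmetric] flip: ennreal_numeral ennreal_plus)
    finally show ?thesis unfolding weighted_sq_integral_parallelogram[OF Fm fm \<omega>] .
  qed
  have "\<exists>n. weighted_sq_integral \<omega> (\<lambda>z. disc_deriv (F n) z - disc_deriv f z) \<le> ennreal \<eta>"
  proof (cases "x = 0")
    case True
    have "weighted_sq_integral \<omega> (\<lambda>z. disc_deriv (F 0) z - disc_deriv f z) \<le> weighted_sq_integral \<omega> (\<lambda>z. disc_deriv (F 0) z - disc_deriv f z) + weighted_sq_integral \<omega> (\<lambda>z. disc_deriv (F 0) z + disc_deriv f z)"
      by simp
    also have "\<dots> \<le> 0" using sum_le[of 0] True by simp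
    finally show ?thesis by (intro exI[of _ 0]) simp
  next
    case False
    have disc_deriv_lim: "(\<lambda>n. disc_deriv (F n) z) \<longlonglongrightarrow> disc_deriv f z" for z
    proof (cases "norm z < 1")
      case True
      have Fd: "disc_deriv (F n) z = of_real (\<rho> n) * deriv f (of_real (\<rho> n) * z)" for n
      proof -
        have "norm (of_real (\<rho> n) * z) < 1"
          using True \<rho>[of n] mult_left_le_one_le[of "norm z" "\<rho> n"] by (simp add: norm_mult)
        then have "(f has_field_derivative deriv f (of_real (\<rho> n) * z)) (at (of_real (\<rho> n) * z))"
          using DERIV_imp_deriv disc_series_has_derivative[OF f] by metis
        from DERIV_chain2[OF _ DERIV_cmult_Id, OF this]
        have "deriv (F n) z = deriv f (of_real (\<rho> n) * z) * of_real (\<rho> n)"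
          unfolding F_def by (rule DERIV_imp_deriv)
        then show ?thesis using True by (simp add: disc_deriv_def)
      qed
      have "continuous_on (ball 0 1) (deriv f)"
        by (intro holomorphic_on_imp_continuous_on holomorphic_deriv disc_series_imp_holomorphic[OF f]) simp
      then have "isCont (deriv f) z" using True by (auto simp: continuous_on_eq_continuous_at)
      moreover have "(\<lambda>n. of_real (\<rho> n) * z) \<longlonglongrightarrow> of_real 1 * z" by (intro tendsto_intros \<rho>_lim)
      ultimately have "(\<lambda>n. deriv f (of_real (\<rho> n) * z)) \<longlonglongrightarrow> deriv f z"
        by (intro isCont_tendsto_compose[where g = "deriv f"]) auto
      then have "(\<lambda>n. of_real (\<rho> n) * deriv f (of_real (\<rho> n) * z)) \<longlonglongrightarrow> of_real 1 * deriv f z"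
        by (intro tendsto_intros \<rho>_lim)
      then show ?thesis
        unfolding Fd using True by (simp add: disc_deriv_def)
    qed (simp add: disc_deriv_def)
    have pointwise: "4 * (ennreal ((norm (disc_deriv f z))\<^sup>2) * disc_weight \<omega> z)
        \<le> liminf (\<lambda>n. ennreal ((norm (disc_deriv (F n) z + disc_deriv f z))\<^sup>2) * disc_weight \<omega> z)" for z
    proof (cases "disc_deriv f z = 0")
      case False
      have eq: "(norm (disc_deriv f z + disc_deriv f z))\<^sup>2 = 4 * (norm (disc_deriv f z))\<^sup>2"
        by (simp add: norm_mult power_mult_distrib flip: mult_2)
      have "(\<lambda>n. ennreal ((norm (disc_deriv (F n) z + disc_deriv f z))\<^sup>2)) \<longlonglongrightarrow> ennreal (4 * (norm (disc_deriv f z))\<^sup>2)"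
        unfolding eq[symmetric] by (intro tendsto_intros disc_deriv_lim)
      then have "(\<lambda>n. ennreal ((norm (disc_deriv (F n) z + disc_deriv f z))\<^sup>2) * disc_weight \<omega> z)
          \<longlonglongrightarrow> ennreal (4 * (norm (disc_deriv f z))\<^sup>2) * disc_weight \<omega> z"
        using False by (intro tendsto_mult_ennreal tendsto_const) auto
      from lim_imp_Liminf[OF _ this] show ?thesis
        by (simp add: ennreal_mult mult.assoc)
    qed simp
    have "ennreal (4 * x) = 4 * weighted_sq_integral \<omega> (disc_deriv f)"
      using x by (simp add: ennreal_mult)
    also have "\<dots> = (\<integral>\<^sup>+ z. 4 * (ennreal ((norm (disc_deriv f z))\<^sup>2) * disc_weight \<omega> z) \<partial>lborel)"
      unfolding weighted_sq_integral_def by (rule nn_integral_cmult[symmetric]) measurable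
    also have "\<dots> \<le> (\<integral>\<^sup>+ z. liminf (\<lambda>n. ennreal ((norm (disc_deriv (F n) z + disc_deriv f z))\<^sup>2) * disc_weight \<omega> z) \<partial>lborel)"
      by (intro nn_integral_mono pointwise)
    also have "\<dots> \<le> liminf (\<lambda>n. weighted_sq_integral \<omega> (\<lambda>z. disc_deriv (F n) z + disc_deriv f z))"
      unfolding weighted_sq_integral_def by (rule nn_integral_liminf) measurable
    finally have "ennreal (4 * x) \<le> liminf (\<lambda>n. weighted_sq_integral \<omega> (\<lambda>z. disc_deriv (F n) z + disc_deriv f z))" .
    moreover have "ennreal (4 * x - \<eta>) < ennreal (4 * x)"
      using False x \<eta> by (intro ennreal_lessI) auto
    ultimately have "ennreal (4 * x - \<eta>) < liminf (\<lambda>n. weighted_sq_integral \<omega> (\<lambda>z. disc_deriv (F n) z + disc_deriv f z))"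
      by (rule less_le_trans[rotated])
    then have "\<forall>\<^sub>F n in sequentially. ennreal (4 * x - \<eta>) < weighted_sq_integral \<omega> (\<lambda>z. disc_deriv (F n) z + disc_deriv f z)"
      by (rule less_LiminfD)
    then obtain n where n: "ennreal (4 * x - \<eta>) < weighted_sq_integral \<omega> (\<lambda>z. disc_deriv (F n) z + disc_deriv f z)"
      by (auto simp: eventually_sequentially)
    have top: "weighted_sq_integral \<omega> (\<lambda>z. disc_deriv (F n) z - disc_deriv f z) \<noteq> top" "weighted_sq_integral \<omega> (\<lambda>z. disc_deriv (F n) z + disc_deriv f z) \<noteq> top"
      using sum_le[of n] by (auto simp: top_unique)
    obtain m where m: "0 \<le> m" "weighted_sq_integral \<omega> (\<lambda>z. disc_deriv (F n) z - disc_deriv f z) = ennreal m"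
      using top(1) by (cases "weighted_sq_integral \<omega> (\<lambda>z. disc_deriv (F n) z - disc_deriv f z)") auto
    obtain p where p: "0 \<le> p" "weighted_sq_integral \<omega> (\<lambda>z. disc_deriv (F n) z + disc_deriv f z) = ennreal p"
      using top(2) by (cases "weighted_sq_integral \<omega> (\<lambda>z. disc_deriv (F n) z + disc_deriv f z)") auto
    have "m + p \<le> 4 * x"
      using sum_le[of n] m p x by (simp add: ennreal_plus[symmetric] ennreal_le_iff del: ennreal_plus)
    moreover have "4 * x - \<eta> < p"
      using n unfolding p(2) by (meson ennreal_leI linorder_not_less)
    ultimately have "m \<le> \<eta>" by simp
    then show ?thesis using m by (intro exI[of _ n]) (simp add: ennreal_leI)
  qed
  then obtain n where "weighted_sq_integral \<omega> (\<lambda>z. disc_deriv (F n) z - disc_deriv f z) \<le> ennreal \<eta>" ..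
  then have "weighted_sq_integral \<omega> (disc_deriv (\<lambda>z. F n z - f z)) \<le> ennreal \<eta>"
    unfolding weighted_sq_integral_def disc_deriv_diff[OF F f] .
  then show ?thesis using that[OF \<rho>] unfolding F_def by blast
qed

section \<open>Convergence of the Cesaro means\<close>

lemma disc_series_polynomial: "disc_series (\<lambda>k. if k \<le> n then b k else 0) (\<lambda>z. \<Sum>k\<le>n. b k * z ^ k)"
  unfolding disc_series_def
proof
  fix z :: complex
  have "(\<lambda>k. (if k \<le> n then b k else 0) * z ^ k) sums (\<Sum>k\<le>n. (if k \<le> n then b k else 0) * z ^ k)"
    by (rule sums_finite) auto
  then show "(\<lambda>k. (if k \<le> n then b k else 0) * z ^ k) sums (\<Sum>k\<le>n. b k * z ^ k)" by simp
qed

lemma disc_series_monomial: "disc_series (\<lambda>k. if k = m then c else 0) (\<lambda>z. c * z ^ m)"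
  unfolding disc_series_def
proof
  fix z :: complex
  have "(\<lambda>k. (if k = m then c else 0) * z ^ k) sums (\<Sum>k\<in>{m}. (if k = m then c else 0) * z ^ k)"
    by (rule sums_finite) auto
  then show "(\<lambda>k. (if k = m then c else 0) * z ^ k) sums (c * z ^ m)" by simp
qed

lemma disc_series_at_0:
  assumes "disc_series a f"
  shows "f 0 = a 0"
proof -
  have "(\<lambda>k. a k * 0 ^ k) sums f 0"
    by (rule bspec[OF assms[unfolded disc_series_def]]) simp
  then show ?thesis by (rule sums_unique2[OF _ powser_sums_zero])
qed

definition cesaro_sum :: "real \<Rightarrow> nat \<Rightarrow> (nat \<Rightarrow> complex) \<Rightarrow> complex \<Rightarrow> complex" where
  "cesaro_sum \<alpha> n a z = (\<Sum>k\<le>n. of_real (cesaro_coeff \<alpha> n k) * a k * z ^ k)"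

lemma cesaro_mean_eq_cesaro_sum: "cesaro_mean \<alpha> n f = cesaro_sum \<alpha> n (fps_nth (fps_expansion f 0))"
  unfolding cesaro_mean_def cesaro_sum_def fun_eq_iff sum_distrib_left
  by (intro allI sum.cong) (auto simp: cesaro_coeff_def divide_inverse mult_ac)

lemma disc_series_cesaro_sum: "disc_series (\<lambda>k. of_real (cesaro_coeff \<alpha> n k) * a k) (cesaro_sum \<alpha> n a)"
proof -
  have "(\<lambda>k. if k \<le> n then of_real (cesaro_coeff \<alpha> n k) * a k else 0) = (\<lambda>k. of_real (cesaro_coeff \<alpha> n k) * a k)"
    by (auto simp: cesaro_coeff_def)
  with disc_series_polynomial[of n "\<lambda>k. of_real (cesaro_coeff \<alpha> n k) * a k"] show ?thesis
    unfolding cesaro_sum_def by simp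
qed

text \<open>
  The bound of \<open>finite_multiplier\<close> for the constant of \<open>sum_cesaro_binomial_increments_le\<close>.
\<close>

definition cesaro_bound :: "real \<Rightarrow> real" where
  "cesaro_bound \<alpha> = 2 + 2 * max 1 (\<alpha>\<^sup>2 / (2 * \<alpha> - 1))"

lemma cesaro_multiplier:
  assumes "\<alpha> > 1 / 2"
  shows "energy_form_multiplier (cesaro_coeff \<alpha> n) (cesaro_bound \<alpha>)"
  unfolding cesaro_bound_def
proof (rule finite_multiplier)
  show "\<bar>cesaro_coeff \<alpha> n j\<bar> \<le> 1" for j using assms by (intro cesaro_coeff_le_1) simp
  show "cesaro_coeff \<alpha> n j = 0" if "j > n" for j using that by (simp add: cesaro_coeff_def)
qed (rule cesaro_coeff_variation[OF assms])

text \<open>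
  Extracting a single Taylor coefficient is a Hadamard multiplier with finite support.
\<close>

lemma weighted_sq_integral_monomial_finite:
  assumes \<omega>: "superharmonic_weight \<omega>" and f: "disc_series a f" and fin: "weighted_sq_integral \<omega> (disc_deriv f) < \<infinity>"
  shows "weighted_sq_integral \<omega> (disc_deriv (\<lambda>z. a m * z ^ m)) < \<infinity>"
proof -
  define c where "c j = (if j = m then 1 else 0 :: real)" for j
  have "energy_form_multiplier c (2 + 2 * (real m * (\<Sum>j\<le>m. (c (Suc j) - c j)\<^sup>2)))"
    by (rule finite_multiplier[where n = m]) (auto simp: c_def)
  moreover have "disc_series (\<lambda>k. of_real (c k) * a k) (\<lambda>z. a m * z ^ m)"
  proof -
    have "(\<lambda>k. of_real (c k) * a k) = (\<lambda>k. if k = m then a m else 0)"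
      by (auto simp: c_def)
    then show ?thesis using disc_series_monomial[of m "a m"] by simp
  qed
  ultimately have "weighted_sq_integral \<omega> (disc_deriv (\<lambda>z. a m * z ^ m))
      \<le> ennreal (2 + 2 * (real m * (\<Sum>j\<le>m. (c (Suc j) - c j)\<^sup>2))) * weighted_sq_integral \<omega> (disc_deriv f)"
    using \<omega> f by (intro multiplier_bound)
  also have "\<dots> < \<infinity>" using fin by (simp add: ennreal_mult_less_top)
  finally show ?thesis .
qed

text \<open>
  Let \<open>m + 1\<close> be the first positive index with a nonzero coefficient. All functions involved have
  derivatives divisible by \<open>z\<^sup>m\<close>, so the derivative of the error is at most a null sequence times that of
  the monomial \<open>a\<^sub>m\<^sub>+\<^sub>1 z\<^sup>m\<^sup>+\<^sup>1\<close>, whose energy is finite by the previous lemma.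
\<close>

lemma cesaro_sum_dilate_tendsto:
  assumes \<omega>: "superharmonic_weight \<omega>" and \<alpha>: "\<alpha> > 0" and f: "disc_series a f" and fin: "weighted_sq_integral \<omega> (disc_deriv f) < \<infinity>"
    and \<rho>: "0 < \<rho>" "\<rho> < 1"
  shows "(\<lambda>n. weighted_sq_integral \<omega> (disc_deriv (\<lambda>z. cesaro_sum \<alpha> n (\<lambda>k. of_real (\<rho> ^ k) * a k) z - f (of_real \<rho> * z)))) \<longlonglongrightarrow> 0"
proof -
  define b where "b k = of_real (\<rho> ^ k) * a k" for k
  define e where "e n k = (of_real (cesaro_coeff \<alpha> n k) - 1) * b k" for n k
  define G where "G n z = cesaro_sum \<alpha> n b z - f (of_real \<rho> * z)" for n z
  have f\<rho>: "disc_series b (\<lambda>z. f (of_real \<rho> * z))"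
    unfolding b_def using \<rho> by (intro disc_series_dilate[OF f]) auto
  have G: "disc_series (e n) (G n)" for n
    using disc_series_diff[OF disc_series_cesaro_sum f\<rho>, of \<alpha> n] unfolding e_def G_def
    by (simp add: left_diff_distrib)
  have lim_goal: "(\<lambda>n. weighted_sq_integral \<omega> (disc_deriv (G n))) \<longlonglongrightarrow> 0"
  proof (cases "\<exists>m. a (Suc m) \<noteq> 0")
    case False
    have "disc_deriv (G n) z = 0" for n z
    proof (cases "norm z < 1")
      case True
      have "diffs (e n) k = 0" for k using False by (simp add: diffs_def e_def b_def)
      then have "(\<lambda>k. 0) sums deriv (G n) z" using disc_series_deriv[OF G True, of n] by simp
      then have "deriv (G n) z = 0" by (rule sums_unique2[OF _ sums_zero])
      then show ?thesis by (simp add: disc_deriv_def)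
    qed (simp add: disc_deriv_def)
    then show ?thesis by (simp add: weighted_sq_integral_def)
  next
    case True
    define m where "m = (LEAST m. a (Suc m) \<noteq> 0)"
    have am: "a (Suc m) \<noteq> 0"
      unfolding m_def by (rule LeastI_ex[OF True])
    have below: "a (Suc k) = 0" if "k < m" for k
      using not_less_Least[OF that[unfolded m_def]] by simp
    define h where "h z = a (Suc m) * z ^ Suc m" for z
    have h_fin: "weighted_sq_integral \<omega> (disc_deriv h) < \<infinity>"
      unfolding h_def by (rule weighted_sq_integral_monomial_finite[OF \<omega> f fin])
    have h_deriv: "disc_deriv h z = of_nat (Suc m) * a (Suc m) * z ^ m" if "norm z < 1" for z
    proof -
      have "(h has_field_derivative a (Suc m) * (of_nat (Suc m) * z ^ m)) (at z)"
        unfolding h_def using DERIV_power_Suc[OF DERIV_ident, of m z] by (intro DERIV_cmult) simp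
      then show ?thesis using that by (simp add: disc_deriv_def DERIV_imp_deriv mult_ac)
    qed
    define d where "d = norm (of_nat (Suc m) * a (Suc m))"
    have d: "d > 0" using am by (simp add: d_def norm_mult del: of_nat_Suc)
    define s where "s n k = \<bar>cesaro_coeff \<alpha> n (Suc k) - 1\<bar> * norm (diffs b k)" for n k
    have b_sum: "summable (\<lambda>k. norm (diffs b k))"
    proof -
      have "summable (\<lambda>k. norm (diffs a k * of_real \<rho> ^ k))"
        using disc_series_abs_summable[OF f, of "of_real \<rho>"] \<rho> by simp
      then have "summable (\<lambda>k. \<rho> * norm (diffs a k * of_real \<rho> ^ k))" by (rule summable_mult)
      also have "(\<lambda>k. \<rho> * norm (diffs a k * of_real \<rho> ^ k)) = (\<lambda>k. norm (diffs b k))"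
        using \<rho> by (auto simp: diffs_def b_def norm_mult norm_power mult_ac fun_eq_iff)
      finally show ?thesis .
    qed
    have s_le: "s n k \<le> 2 * norm (diffs b k)" for n k
      unfolding s_def using cesaro_coeff_le_1[OF \<alpha>, of n "Suc k"] by (intro mult_right_mono) auto
    have s_nonneg: "0 \<le> s n k" for n k by (simp add: s_def)
    have s_sum: "summable (s n)" for n
      by (rule summable_comparison_test'[OF summable_mult[OF b_sum, of 2]])
        (use s_le s_nonneg in auto)
    have s_lim: "(\<lambda>n. \<Sum>k. s n k) \<longlonglongrightarrow> 0"
    proof -
      have "(\<lambda>n. \<Sum>k. s n k) \<longlonglongrightarrow> (\<Sum>k. 0)"
      proof (rule tannerys_theorem[where a = "\<lambda>k n. s n k" and b = "\<lambda>_. 0" and F = sequentially, THEN conjunct2, THEN conjunct2])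
        \<comment> \<open>The factor 2 bounds \<open>\<bar>cesaro_coeff \<alpha> n (Suc k) - 1\<bar>\<close>.\<close>
        show "summable (\<lambda>k. 2 * norm (diffs b k))" by (intro summable_mult b_sum)
        show "((\<lambda>n. s n k) \<longlongrightarrow> 0) sequentially" for k
        proof -
          have "(\<lambda>n. \<bar>cesaro_coeff \<alpha> n (Suc k) - 1\<bar> * norm (diffs b k)) \<longlonglongrightarrow> \<bar>1 - 1\<bar> * norm (diffs b k)"
            by (intro tendsto_intros cesaro_coeff_tendsto_1[OF \<alpha>])
          then show ?thesis by (simp add: s_def)
        qed
      qed (use s_le s_nonneg in \<open>auto intro!: always_eventually\<close>)
      then show ?thesis by simp
    qed
    have G_le: "norm (disc_deriv (G n) z) \<le> ((\<Sum>k. s n k) / d) * norm (disc_deriv h z)" for n z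
    proof (cases "norm z < 1")
      case True
      have summand_le: "norm (diffs (e n) k * z ^ k) \<le> s n k * norm z ^ m" for k
      proof (cases "k < m")
        case True
        then show ?thesis using below by (simp add: diffs_def e_def b_def s_def)
      next
        case False
        have "norm (diffs (e n) k) = s n k"
        proof -
          have "diffs (e n) k = of_real (cesaro_coeff \<alpha> n (Suc k) - 1) * diffs b k"
            by (simp add: diffs_def e_def mult_ac)
          then show ?thesis by (simp only: s_def norm_mult norm_of_real)
        qed
        moreover have "norm z ^ k \<le> norm z ^ m"
          using False True by (intro power_decreasing) auto
        ultimately show ?thesis by (simp add: norm_mult norm_power mult_left_mono s_nonneg)
      qed
      have "norm (deriv (G n) z) = norm (\<Sum>k. diffs (e n) k * z ^ k)"
        using disc_series_deriv[OF G True] by (simp add: sums_iff)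
      also have "\<dots> \<le> (\<Sum>k. norm (diffs (e n) k * z ^ k))"
        by (rule summable_norm[OF disc_series_abs_summable[OF G True]])
      also have "\<dots> \<le> (\<Sum>k. s n k * norm z ^ m)"
        by (intro suminf_le summand_le disc_series_abs_summable[OF G True] summable_mult2 s_sum)
      also have "\<dots> = (\<Sum>k. s n k) * norm z ^ m"
        by (rule suminf_mult2[OF s_sum, symmetric])
      also have "\<dots> = ((\<Sum>k. s n k) / d) * norm (disc_deriv h z)"
      proof -
        have "norm (disc_deriv h z) = d * norm z ^ m"
          unfolding h_deriv[OF True] d_def norm_mult norm_power ..
        then show ?thesis using d by simp
      qed
      finally show ?thesis using True by (simp add: disc_deriv_def)
    qed (simp add: disc_deriv_def)
    have hm: "disc_deriv h \<in> borel_measurable borel"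
    proof -
      have "disc_series (\<lambda>k. if k = Suc m then a (Suc m) else 0) h"
        unfolding h_def by (rule disc_series_monomial)
      then show ?thesis by (rule disc_deriv_measurable)
    qed
    have weighted_sq_integral_le: "weighted_sq_integral \<omega> (disc_deriv (G n)) \<le> ennreal (((\<Sum>k. s n k) / d)\<^sup>2) * weighted_sq_integral \<omega> (disc_deriv h)" for n
    proof (rule weighted_sq_integral_mono[OF G_le _ hm \<omega>])
      show "0 \<le> (\<Sum>k. s n k) / d" using d s_sum s_nonneg by (intro divide_nonneg_pos suminf_nonneg) auto
    qed
    have "(\<lambda>n. ennreal (((\<Sum>k. s n k) / d)\<^sup>2)) \<longlonglongrightarrow> ennreal ((0 / d)\<^sup>2)"
      using d by (intro tendsto_intros s_lim) auto
    then have "(\<lambda>n. weighted_sq_integral \<omega> (disc_deriv h) * ennreal (((\<Sum>k. s n k) / d)\<^sup>2)) \<longlonglongrightarrow> weighted_sq_integral \<omega> (disc_deriv h) * ennreal ((0 / d)\<^sup>2)"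
      using h_fin by (intro ennreal_tendsto_cmult) auto
    then have lim0: "(\<lambda>n. ennreal (((\<Sum>k. s n k) / d)\<^sup>2) * weighted_sq_integral \<omega> (disc_deriv h)) \<longlonglongrightarrow> 0"
      by (simp add: mult.commute)
    show ?thesis
      by (rule tendsto_sandwich[OF _ _ tendsto_const lim0]) (simp_all add: weighted_sq_integral_le)
  qed
  then show ?thesis unfolding G_def b_def .
qed

text \<open>
  With \<open>g\<close> a dilate of \<open>f\<close> and \<open>\<sigma>\<^sub>n\<close> the Cesaro mean, the proof splits
  \<open>\<sigma>\<^sub>n f - f = \<sigma>\<^sub>n (f - g) + (\<sigma>\<^sub>n g - g) + (g - f)\<close>. The outer terms are small uniformly in \<open>n\<close> by the
  multiplier bound, and the middle one tends to 0.
\<close>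

theorem cesaro_sum_converges:
  assumes \<omega>: "superharmonic_weight \<omega>" and \<alpha>: "\<alpha> > 1 / 2" and f: "disc_series a f" and fin: "weighted_sq_integral \<omega> (disc_deriv f) < \<infinity>"
  shows "(\<lambda>n. weighted_sq_integral \<omega> (disc_deriv (\<lambda>z. cesaro_sum \<alpha> n a z - f z))) \<longlonglongrightarrow> 0"
proof -
  define \<kappa> where "\<kappa> = cesaro_bound \<alpha>"
  have \<kappa>: "\<kappa> > 0" unfolding \<kappa>_def cesaro_bound_def by (simp add: max_def)
  define S where "S n = cesaro_sum \<alpha> n a" for n
  have S: "disc_series (\<lambda>k. of_real (cesaro_coeff \<alpha> n k) * a k) (S n)" for n
    unfolding S_def by (rule disc_series_cesaro_sum)
  have small: "\<forall>\<^sub>F n in sequentially. weighted_sq_integral \<omega> (disc_deriv (\<lambda>z. S n z - f z)) \<le> ennreal \<delta>" if \<delta>: "0 < \<delta>" for \<delta>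
  proof -
    \<comment> \<open>The three terms of the splitting contribute at most \<open>(8 + 2 \<kappa>) \<eta>\<close>.\<close>
    define \<eta> where "\<eta> = \<delta> / (8 * (\<kappa> + 1))"
    have \<eta>: "\<eta> > 0" using \<delta> \<kappa> by (simp add: \<eta>_def)
    obtain \<rho> where \<rho>: "0 < \<rho>" "\<rho> < 1" and fine: "weighted_sq_integral \<omega> (disc_deriv (\<lambda>z. f (of_real \<rho> * z) - f z)) \<le> ennreal \<eta>"
      using dilates_approximate[OF \<omega> f fin \<eta>] .
    define g where "g z = f (of_real \<rho> * z)" for z
    define b where "b k = of_real (\<rho> ^ k) * a k" for k
    define T where "T n = cesaro_sum \<alpha> n b" for n
    have g: "disc_series b g"
      unfolding b_def g_def using \<rho> by (intro disc_series_dilate[OF f]) auto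
    have T: "disc_series (\<lambda>k. of_real (cesaro_coeff \<alpha> n k) * b k) (T n)" for n
      unfolding T_def by (rule disc_series_cesaro_sum)
    note gf = disc_series_diff[OF g f]
    have TS: "disc_series (\<lambda>k. of_real (cesaro_coeff \<alpha> n k) * (b k - a k)) (\<lambda>z. T n z - S n z)" for n
      using disc_series_diff[OF T S, of n n] by (simp add: right_diff_distrib)
    have 1: "weighted_sq_integral \<omega> (disc_deriv (\<lambda>z. T n z - S n z)) \<le> ennreal \<kappa> * ennreal \<eta>" for n
    proof -
      have "weighted_sq_integral \<omega> (disc_deriv (\<lambda>z. T n z - S n z)) \<le> ennreal \<kappa> * weighted_sq_integral \<omega> (disc_deriv (\<lambda>z. g z - f z))"
        unfolding \<kappa>_def by (rule multiplier_bound[OF cesaro_multiplier[OF \<alpha>] \<omega> gf TS])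
      also have "\<dots> \<le> ennreal \<kappa> * ennreal \<eta>"
        using fine unfolding g_def by (rule mult_left_mono) simp
      finally show ?thesis .
    qed
    have "(\<lambda>n. weighted_sq_integral \<omega> (disc_deriv (\<lambda>z. T n z - g z))) \<longlonglongrightarrow> 0"
      unfolding T_def g_def b_def using \<alpha> by (intro cesaro_sum_dilate_tendsto[OF \<omega> _ f fin \<rho>]) simp
    then have "\<forall>\<^sub>F n in sequentially. weighted_sq_integral \<omega> (disc_deriv (\<lambda>z. T n z - g z)) < ennreal \<eta>"
      using \<eta> by (intro order_tendstoD) auto
    then show ?thesis
    proof eventually_elim
      case (elim n)
      have m1: "disc_deriv (\<lambda>z. T n z - S n z) \<in> borel_measurable borel" by (rule disc_deriv_measurable[OF TS])
      have m2: "disc_deriv (\<lambda>z. T n z - g z) \<in> borel_measurable borel" by (rule disc_deriv_measurable[OF disc_series_diff[OF T g]])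
      have m3: "disc_deriv (\<lambda>z. g z - f z) \<in> borel_measurable borel" by (rule disc_deriv_measurable[OF gf])
      define A where "A z = disc_deriv (\<lambda>z. T n z - g z) z + disc_deriv (\<lambda>z. g z - f z) z" for z
      have Am: "A \<in> borel_measurable borel" unfolding A_def using m2 m3 by measurable
      have A: "weighted_sq_integral \<omega> A \<le> ennreal (4 * \<eta>)"
      proof -
        have "weighted_sq_integral \<omega> A \<le> 2 * weighted_sq_integral \<omega> (disc_deriv (\<lambda>z. T n z - g z)) + 2 * weighted_sq_integral \<omega> (disc_deriv (\<lambda>z. g z - f z))"
          unfolding A_def by (rule weighted_sq_integral_add_le[OF m2 m3 \<omega>])
        also have "\<dots> \<le> 2 * ennreal \<eta> + 2 * ennreal \<eta>"
          using elim fine unfolding g_def by (intro add_mono mult_left_mono) (auto simp: less_imp_le)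
        also have "\<dots> = ennreal (4 * \<eta>)"
          using \<eta> by (simp add: ennreal_mult distrib_right[symmetric] flip: ennreal_numeral ennreal_plus)
        finally show ?thesis .
      qed
      have "disc_deriv (\<lambda>z. S n z - f z) z = A z - disc_deriv (\<lambda>z. T n z - S n z) z" for z
        unfolding A_def disc_deriv_diff[OF S f] disc_deriv_diff[OF T g] disc_deriv_diff[OF g f] disc_deriv_diff[OF T S] by simp
      then have "weighted_sq_integral \<omega> (disc_deriv (\<lambda>z. S n z - f z)) = weighted_sq_integral \<omega> (\<lambda>z. A z - disc_deriv (\<lambda>z. T n z - S n z) z)"
        unfolding weighted_sq_integral_def by simp
      also have "\<dots> \<le> 2 * weighted_sq_integral \<omega> A + 2 * weighted_sq_integral \<omega> (disc_deriv (\<lambda>z. T n z - S n z))"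
        unfolding weighted_sq_integral_parallelogram[OF Am m1 \<omega>, symmetric] by simp
      also have "\<dots> \<le> 2 * ennreal (4 * \<eta>) + 2 * (ennreal \<kappa> * ennreal \<eta>)"
        using A 1[of n] by (intro add_mono mult_left_mono) auto
      also have "\<dots> = ennreal (8 * \<eta> + 2 * (\<kappa> * \<eta>))"
        using \<eta> \<kappa> by (simp add: ennreal_mult)
      also have "\<dots> \<le> ennreal \<delta>"
      proof (rule ennreal_leI)
        have "8 * \<eta> + 2 * (\<kappa> * \<eta>) \<le> 8 * (\<kappa> + 1) * \<eta>" using \<eta> \<kappa> by (simp add: algebra_simps)
        also have "\<dots> = \<delta>" using \<kappa> by (simp add: \<eta>_def)
        finally show "8 * \<eta> + 2 * (\<kappa> * \<eta>) \<le> \<delta>" .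
      qed
      finally show ?case .
    qed
  qed
  have "(\<lambda>n. weighted_sq_integral \<omega> (disc_deriv (\<lambda>z. S n z - f z))) \<longlonglongrightarrow> 0"
  proof (rule order_tendstoI)
    fix y :: ennreal assume "0 < y"
    then obtain x where x: "0 < x" "x < y" using dense by blast
    then obtain \<delta> where \<delta>: "0 < \<delta>" "x = ennreal \<delta>" by (cases x) auto
    show "\<forall>\<^sub>F n in sequentially. weighted_sq_integral \<omega> (disc_deriv (\<lambda>z. S n z - f z)) < y"
      using small[OF \<delta>(1)] by eventually_elim (use x \<delta> in auto)
  qed simp
  then show ?thesis unfolding S_def .
qed

theorem theorem1p1:
  fixes \<omega> :: "complex \<Rightarrow> ereal" and f :: "complex \<Rightarrow> complex" and \<alpha> :: real
  assumes "superharmonic_weight \<omega>"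
    and "f \<in> dirichlet_space \<omega>"
    and "\<alpha> > 1 / 2"
  shows "(\<lambda>n. dirichlet_norm \<omega> (\<lambda>z. cesaro_mean \<alpha> n f z - f z)) \<longlonglongrightarrow> 0"
proof -
  define a where "a = fps_nth (fps_expansion f 0)"
  have f: "disc_series a f" and fin: "dirichlet_integral \<omega> f < \<infinity>"
    using assms(2) disc_series_holomorphic by (auto simp: dirichlet_space_def a_def)
  have \<alpha>: "\<alpha> > 0" using assms(3) by simp
  have "weighted_sq_integral \<omega> (disc_deriv f) < \<infinity>"
    using fin unfolding dirichlet_integral_eq_weighted_sq_integral by (auto simp: ennreal_mult_less_top)
  note lim = cesaro_sum_converges[OF assms(1,3) f this]
  define I where "I n = dirichlet_integral \<omega> (\<lambda>z. cesaro_mean \<alpha> n f z - f z)" for n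
  have "(\<lambda>n. ennreal (1 / pi) * weighted_sq_integral \<omega> (disc_deriv (\<lambda>z. cesaro_sum \<alpha> n a z - f z))) \<longlonglongrightarrow> ennreal (1 / pi) * 0"
    by (intro ennreal_tendsto_cmult lim) simp
  then have I_lim: "I \<longlonglongrightarrow> 0"
    unfolding I_def dirichlet_integral_eq_weighted_sq_integral cesaro_mean_eq_cesaro_sum a_def by simp
  have at_0: "cesaro_mean \<alpha> n f 0 - f 0 = 0" for n
    using disc_series_at_0[OF disc_series_cesaro_sum, of \<alpha> n a] disc_series_at_0[OF f] cesaro_coeff_0[OF \<alpha>]
    unfolding cesaro_mean_eq_cesaro_sum a_def[symmetric] by simp
  have "(\<lambda>n. ennreal (sqrt (enn2real (I n)))) \<longlonglongrightarrow> ennreal (sqrt 0)"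
    using I_lim by (intro tendsto_ennrealI tendsto_real_sqrt tendsto_enn2real) (auto simp: zero_ennreal_def[symmetric])
  moreover have "\<forall>\<^sub>F n in sequentially. ennreal (sqrt (enn2real (I n))) = dirichlet_norm \<omega> (\<lambda>z. cesaro_mean \<alpha> n f z - f z)"
    using order_tendstoD(2)[OF I_lim, of \<infinity>]
    by (auto elim!: eventually_mono simp: dirichlet_norm_def I_def at_0)
  ultimately show ?thesis by (auto intro: Lim_transform_eventually)
qed

end
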